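(* Let $X_1$ and $X_2$ be two diffeological spaces, let $Y\subseteq X_1$, let $f:Y\to X_2$ be a smooth map (for the subset diffeology on $Y$), and let $i:Y\hookrightarrow X_1$ and $j:f(Y)\hookrightarrow X_2$ be the natural inclusions. Let $m\geqslant 0$ be an integer. Then $\Omega^m(X_1\cup_f X_2)$ is diffeomorphic to the subset $\Omega_f^m(X_1)\oplus_{comp}\Omega^m(X_2)$ of $\Omega^m(X_1)\oplus\Omega^m(X_2)$ consisting of all pairs $(\omega_1,\omega_2)$ such that $i^*\omega_1=f^*j^*\omega_2$ and $\omega_1$ is $f$-invariant.
   Context: A diffeology on a set $X$ is a set of maps (plots) $p:U\to X$, with $U$ a domain (open set) in some $\mathbb{R}^n$ ($n$ varying), that contains all constant maps, is closed under precomposition with ordinary smooth maps between domains, and contains every map that is locally a plot. A map between diffeological spaces is smooth if its composition with every plot is a plot; a diffeomorphism is a smooth bijection with smooth inverse. Subsets carry the subset diffeology (plots with range in the subset), disjoint unions the finest diffeology making the inclusions smooth, direct products the coarsest diffeology making the projections smooth, quotients the quotient diffeology (the finest making the quotient projection smooth). A differential $m$-form $\omega$ on $X$ assigns to each plot $p:U\to X$ an ordinary smooth $m$-form $\omega(p)$ on $U$ such that $\omega(p\circ F)=F^*(\omega(p))$ for every smooth $F:U'\to U$. For a smooth map $g:A\to B$, $(g^*\omega)(p)=\omega(g\circ p)$. $\Omega^m(X)$ is the vector space of all $m$-forms on $X$ with the functional diffeology: $Q:U'\to\Omega^m(X)$ is a plot iff for every plot $p:U\to X$, $U\subseteq\mathbb{R}^n$,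 the map $U'\times U\to\Lambda^m(\mathbb{R}^n)$, $(u',u)\mapsto Q(u')(p)(u)$, is smooth. Direct sums carry the product diffeology and subspaces the subset diffeology. $X_1\cup_f X_2=(X_1\sqcup X_2)/\!\sim$, where $\sim$ is the equivalence relation generated by $y\sim f(y)$, $y\in Y$, with the quotient diffeology. In $i^*\omega_1=f^*j^*\omega_2$, $f$ is regarded as a map $Y\to f(Y)$, with $Y$ and $f(Y)$ carrying subset diffeologies. Two plots $p_1,p_1'$ of $X_1$ are $f$-equivalent if they have the same domain $U$ and for all $u\in U$ with $p_1(u)\neq p_1'(u)$ we have $p_1(u),p_1'(u)\in Y$ and $f(p_1(u))=f(p_1'(u))$. A form $\omega_1\in\Omega^m(X_1)$ is $f$-invariant if $\omega_1(p_1)=\omega_1(p_1')$ for any two $f$-equivalent plots $p_1,p_1'$. *)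

theory Defs
  imports "HOL-Analysis.Analysis"
begin

section \<open>Smooth maps between domains\<close>

text \<open>
  The space \<open>\<real>\<^sup>n\<close>, for \<open>n\<close> a natural number that varies inside the definitions below, is the
  library's \<^const>\<open>Euclidean_space\<close>: its points are the sequences \<open>x :: nat \<Rightarrow> real\<close> with
  \<open>x i = 0\<close> for \<open>i \<ge> n\<close>. A domain in \<open>\<real>\<^sup>n\<close> is a set \<open>U\<close> with \<open>openin (Euclidean_space n) U\<close>.
\<close>

abbreviation Rn :: "nat \<Rightarrow> (nat \<Rightarrow> real) set"
  where "Rn n \<equiv> topspace (Euclidean_space n)"

definition partial :: "nat \<Rightarrow> ((nat \<Rightarrow> real) \<Rightarrow> real) \<Rightarrow> (nat \<Rightarrow> real) \<Rightarrow> real"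
  where "partial j g u = deriv (\<lambda>t. g (u(j := t))) (u j)"

text \<open>
  \<open>C_diff k n U g\<close>: the function \<open>g\<close> is of class \<open>C\<^sup>k\<close> on the domain \<open>U\<close> in \<open>\<real>\<^sup>n\<close>. As \<open>U\<close> is open,
  this and the values of \<^const>\<open>partial\<close> on \<open>U\<close> depend on \<open>g\<close> only through its restriction to \<open>U\<close>.
\<close>

primrec C_diff :: "nat \<Rightarrow> nat \<Rightarrow> (nat \<Rightarrow> real) set \<Rightarrow> ((nat \<Rightarrow> real) \<Rightarrow> real) \<Rightarrow> bool" where
  "C_diff 0 n U g \<longleftrightarrow> continuous_on U g"
| "C_diff (Suc k) n U g \<longleftrightarrow> continuous_on U g \<and>
     (\<forall>j<n. (\<forall>u\<in>U. (\<lambda>t. g (u(j := t))) field_differentiable at (u j)) \<and>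
            C_diff k n U (partial j g))"

definition C_infinity :: "nat \<Rightarrow> (nat \<Rightarrow> real) set \<Rightarrow> ((nat \<Rightarrow> real) \<Rightarrow> real) \<Rightarrow> bool"
  where "C_infinity n U g \<longleftrightarrow> (\<forall>k. C_diff k n U g)"

definition smooth_between ::
  "nat \<Rightarrow> (nat \<Rightarrow> real) set \<Rightarrow> nat \<Rightarrow> (nat \<Rightarrow> real) set \<Rightarrow> ((nat \<Rightarrow> real) \<Rightarrow> (nat \<Rightarrow> real)) \<Rightarrow> bool"
  where "smooth_between n' U' n U F \<longleftrightarrow>
    openin (Euclidean_space n') U' \<and> openin (Euclidean_space n) U \<and>
    F \<in> U' \<rightarrow> U \<and> (\<forall>i<n. C_infinity n' U' (\<lambda>u. F u i))"

definition differential ::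
  "nat \<Rightarrow> ((nat \<Rightarrow> real) \<Rightarrow> (nat \<Rightarrow> real)) \<Rightarrow> (nat \<Rightarrow> real) \<Rightarrow> (nat \<Rightarrow> real) \<Rightarrow> (nat \<Rightarrow> real)"
  where "differential n' F u v = (\<lambda>i. \<Sum>j<n'. partial j (\<lambda>x. F x i) u * v j)"


section \<open>Ordinary differential forms on domains\<close>

definition vector_tuples :: "nat \<Rightarrow> nat \<Rightarrow> (nat \<Rightarrow> real) list set"
  where "vector_tuples m n = {vs. length vs = m \<and> set vs \<subseteq> Rn n}"

text \<open>
  \<open>covectors m n\<close> is \<open>\<Lambda>\<^sup>m(\<real>\<^sup>n)\<close>, the alternating \<open>m\<close>-linear forms on \<open>\<real>\<^sup>n\<close>. So that each of them is
  represented by exactly one HOL function, they are extended by zero to all other lists.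
\<close>

definition covectors :: "nat \<Rightarrow> nat \<Rightarrow> ((nat \<Rightarrow> real) list \<Rightarrow> real) set"
  where "covectors m n = {\<alpha>.
    (\<forall>vs. vs \<notin> vector_tuples m n \<longrightarrow> \<alpha> vs = 0) \<and>
    (\<forall>vs\<in>vector_tuples m n. \<forall>i<m. \<forall>x\<in>Rn n. \<forall>y\<in>Rn n. \<forall>a b.
       \<alpha> (vs[i := (\<lambda>k. a * x k + b * y k)]) = a * \<alpha> (vs[i := x]) + b * \<alpha> (vs[i := y])) \<and>
    (\<forall>vs\<in>vector_tuples m n. \<forall>i<m. \<forall>j<m. i \<noteq> j \<longrightarrow> vs ! i = vs ! j \<longrightarrow> \<alpha> vs = 0)}"

text \<open>
  Smoothness of a map from a domain \<open>W\<close> in \<open>\<real>\<^sup>k\<close> to the finite-dimensional vector space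
  \<open>\<Lambda>\<^sup>m(\<real>\<^sup>n)\<close>; its linear coordinates are evaluations at tuples of vectors.
\<close>

definition smooth_to_covectors ::
  "nat \<Rightarrow> nat \<Rightarrow> nat \<Rightarrow> (nat \<Rightarrow> real) set \<Rightarrow> ((nat \<Rightarrow> real) \<Rightarrow> (nat \<Rightarrow> real) list \<Rightarrow> real) \<Rightarrow> bool"
  where "smooth_to_covectors m n k W \<eta> \<longleftrightarrow>
    (\<forall>w\<in>W. \<eta> w \<in> covectors m n) \<and>
    (\<forall>vs\<in>vector_tuples m n. C_infinity k W (\<lambda>w. \<eta> w vs))"

definition domain_forms ::
  "nat \<Rightarrow> nat \<Rightarrow> (nat \<Rightarrow> real) set \<Rightarrow> ((nat \<Rightarrow> real) \<Rightarrow> (nat \<Rightarrow> real) list \<Rightarrow> real) set"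
  where "domain_forms m n U = {\<eta>.
    smooth_to_covectors m n n U \<eta> \<and> (\<forall>u. u \<notin> U \<longrightarrow> \<eta> u = (\<lambda>vs. 0))}"

text \<open>
  \<open>domain_pullback m n' U' F \<eta>\<close> is \<open>F\<^sup>*\<eta>\<close> for a smooth map \<open>F\<close> from the domain \<open>U'\<close> in \<open>\<real>\<^bsup>n'\<^esup>\<close>
  to the domain on which the \<open>m\<close>-form \<open>\<eta>\<close> is defined.
\<close>

definition domain_pullback ::
  "nat \<Rightarrow> nat \<Rightarrow> (nat \<Rightarrow> real) set \<Rightarrow> ((nat \<Rightarrow> real) \<Rightarrow> (nat \<Rightarrow> real)) \<Rightarrow>
   ((nat \<Rightarrow> real) \<Rightarrow> (nat \<Rightarrow> real) list \<Rightarrow> real) \<Rightarrow> ((nat \<Rightarrow> real) \<Rightarrow> (nat \<Rightarrow> real) list \<Rightarrow> real)"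
  where "domain_pullback m n' U' F \<eta> = (\<lambda>u vs.
    if u \<in> U' \<and> vs \<in> vector_tuples m n' then \<eta> (F u) (map (differential n' F u) vs) else 0)"


section \<open>Diffeological spaces\<close>

text \<open>
  A map \<open>p : U \<rightarrow> X\<close> on a domain \<open>U\<close> in \<open>\<real>\<^sup>n\<close> is the triple \<open>(n, U, p)\<close> with \<open>p\<close> extensional on \<open>U\<close>.
\<close>

type_synonym 'a plot = "nat \<times> (nat \<Rightarrow> real) set \<times> ((nat \<Rightarrow> real) \<Rightarrow> 'a)"

definition parametrizations :: "'a set \<Rightarrow> 'a plot set"
  where "parametrizations X = {(n, U, p). openin (Euclidean_space n) U \<and> p \<in> U \<rightarrow>\<^sub>E X}"

definition diffeology :: "'a set \<Rightarrow> 'a plot set \<Rightarrow> bool"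
  where "diffeology X D \<longleftrightarrow>
    D \<subseteq> parametrizations X \<and>
    (\<forall>n U x. openin (Euclidean_space n) U \<longrightarrow> x \<in> X \<longrightarrow> (n, U, \<lambda>u\<in>U. x) \<in> D) \<and>
    (\<forall>n U p n' U' F. (n, U, p) \<in> D \<longrightarrow> smooth_between n' U' n U F \<longrightarrow>
       (n', U', compose U' p F) \<in> D) \<and>
    (\<forall>n U p. (n, U, p) \<in> parametrizations X \<longrightarrow>
       (\<forall>u\<in>U. \<exists>V. openin (Euclidean_space n) V \<and> u \<in> V \<and> V \<subseteq> U \<and> (n, V, restrict p V) \<in> D) \<longrightarrow>
       (n, U, p) \<in> D)"

record 'a diffeo_space =
  points :: "'a set"
  plots :: "'a plot set"

definition diffeological_space :: "'a diffeo_space \<Rightarrow> bool"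
  where "diffeological_space X \<longleftrightarrow> diffeology (points X) (plots X)"

definition smooth :: "'a diffeo_space \<Rightarrow> 'b diffeo_space \<Rightarrow> ('a \<Rightarrow> 'b) \<Rightarrow> bool"
  where "smooth X Z g \<longleftrightarrow> g \<in> points X \<rightarrow> points Z \<and>
    (\<forall>n U p. (n, U, p) \<in> plots X \<longrightarrow> (n, U, compose U g p) \<in> plots Z)"

definition diffeomorphism :: "'a diffeo_space \<Rightarrow> 'b diffeo_space \<Rightarrow> ('a \<Rightarrow> 'b) \<Rightarrow> bool"
  where "diffeomorphism X Z h \<longleftrightarrow>
    smooth X Z h \<and> bij_betw h (points X) (points Z) \<and> smooth Z X (inv_into (points X) h)"

definition diffeomorphic :: "'a diffeo_space \<Rightarrow> 'b diffeo_space \<Rightarrow> bool"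
  where "diffeomorphic X Z \<longleftrightarrow> (\<exists>h. diffeomorphism X Z h)"


section \<open>Constructions of diffeological spaces\<close>

text \<open>
  One diffeology is finer than another if it has fewer plots, so the finest diffeology with some
  property is the least one with respect to inclusion, and the coarsest one is the greatest.
\<close>

definition subset_space :: "'a diffeo_space \<Rightarrow> 'a set \<Rightarrow> 'a diffeo_space"
  where "subset_space X A =
    \<lparr>points = A, plots = {(n, U, p). (n, U, p) \<in> plots X \<and> p ` U \<subseteq> A}\<rparr>"

definition sum_space :: "'a diffeo_space \<Rightarrow> 'b diffeo_space \<Rightarrow> ('a + 'b) diffeo_space"
  where "sum_space X Z =
    \<lparr>points = points X <+> points Z,
     plots = (LEAST D. diffeology (points X <+> points Z) D \<and>
       smooth X \<lparr>points = points X <+> points Z, plots = D\<rparr> Inl \<and>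
       smooth Z \<lparr>points = points X <+> points Z, plots = D\<rparr> Inr)\<rparr>"

definition prod_space :: "'a diffeo_space \<Rightarrow> 'b diffeo_space \<Rightarrow> ('a \<times> 'b) diffeo_space"
  where "prod_space X Z =
    \<lparr>points = points X \<times> points Z,
     plots = (GREATEST D. diffeology (points X \<times> points Z) D \<and>
       smooth \<lparr>points = points X \<times> points Z, plots = D\<rparr> X fst \<and>
       smooth \<lparr>points = points X \<times> points Z, plots = D\<rparr> Z snd)\<rparr>"

definition quotient_space :: "'a diffeo_space \<Rightarrow> ('a \<times> 'a) set \<Rightarrow> 'a set diffeo_space"
  where "quotient_space X r =
    \<lparr>points = points X // r,
     plots = (LEAST D. diffeology (points X // r) D \<and>
       smooth X \<lparr>points = points X // r, plots = D\<rparr> (\<lambda>x. r `` {x}))\<rparr>"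

definition gluing_relation ::
  "'a diffeo_space \<Rightarrow> 'b diffeo_space \<Rightarrow> 'a set \<Rightarrow> ('a \<Rightarrow> 'b) \<Rightarrow> (('a + 'b) \<times> ('a + 'b)) set"
  where "gluing_relation X1 X2 Y f =
    {(a, b). a \<in> points (sum_space X1 X2) \<and> b \<in> points (sum_space X1 X2) \<and>
       equivclp (\<lambda>s t. \<exists>y\<in>Y. s = Inl y \<and> t = Inr (f y)) a b}"

definition gluing ::
  "'a diffeo_space \<Rightarrow> 'b diffeo_space \<Rightarrow> 'a set \<Rightarrow> ('a \<Rightarrow> 'b) \<Rightarrow> ('a + 'b) set diffeo_space"
  where "gluing X1 X2 Y f = quotient_space (sum_space X1 X2) (gluing_relation X1 X2 Y f)"


section \<open>Differential forms on diffeological spaces\<close>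

type_synonym 'a form = "'a plot \<Rightarrow> (nat \<Rightarrow> real) \<Rightarrow> (nat \<Rightarrow> real) list \<Rightarrow> real"

text \<open>A form is extended by zero to the triples that are not plots of the space.\<close>

definition forms :: "nat \<Rightarrow> 'a diffeo_space \<Rightarrow> 'a form set"
  where "forms m X = {\<omega>.
    (\<forall>P. P \<notin> plots X \<longrightarrow> \<omega> P = (\<lambda>u vs. 0)) \<and>
    (\<forall>n U p. (n, U, p) \<in> plots X \<longrightarrow>
       \<omega> (n, U, p) \<in> domain_forms m n U \<and>
       (\<forall>n' U' F. smooth_between n' U' n U F \<longrightarrow>
          \<omega> (n', U', compose U' p F) = domain_pullback m n' U' F (\<omega> (n, U, p))))}"

definition pullback :: "'a diffeo_space \<Rightarrow> ('a \<Rightarrow> 'b) \<Rightarrow> 'b form \<Rightarrow> 'a form"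
  where "pullback A g \<omega> = (\<lambda>(n, U, p).
    if (n, U, p) \<in> plots A then \<omega> (n, U, compose U g p) else (\<lambda>u vs. 0))"

text \<open>
  The product of domains \<open>U'\<close> in \<open>\<real>\<^sup>k\<close> and \<open>U\<close> in \<open>\<real>\<^sup>n\<close>, as a domain in \<open>\<real>\<^bsup>k+n\<^esup>\<close>: the first \<open>k\<close>
  coordinates of a point form its component in \<open>U'\<close>, the remaining \<open>n\<close> its component in \<open>U\<close>.
\<close>

definition first_part :: "nat \<Rightarrow> (nat \<Rightarrow> real) \<Rightarrow> (nat \<Rightarrow> real)"
  where "first_part k w = (\<lambda>i. if i < k then w i else 0)"

definition second_part :: "nat \<Rightarrow> (nat \<Rightarrow> real) \<Rightarrow> (nat \<Rightarrow> real)"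
  where "second_part k w = (\<lambda>i. w (k + i))"

definition domain_product ::
  "nat \<Rightarrow> (nat \<Rightarrow> real) set \<Rightarrow> nat \<Rightarrow> (nat \<Rightarrow> real) set \<Rightarrow> (nat \<Rightarrow> real) set"
  where "domain_product k U' n U = {w \<in> Rn (k + n). first_part k w \<in> U' \<and> second_part k w \<in> U}"

definition Omega :: "nat \<Rightarrow> 'a diffeo_space \<Rightarrow> 'a form diffeo_space"
  where "Omega m X =
    \<lparr>points = forms m X,
     plots = {(k, U', Q). (k, U', Q) \<in> parametrizations (forms m X) \<and>
       (\<forall>n U p. (n, U, p) \<in> plots X \<longrightarrow>
          smooth_to_covectors m n (k + n) (domain_product k U' n U)
            (\<lambda>w. Q (first_part k w) (n, U, p) (second_part k w)))}\<rparr>"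


section \<open>Forms on the two factors of a gluing\<close>

definition f_equivalent ::
  "'a set \<Rightarrow> ('a \<Rightarrow> 'b) \<Rightarrow> (nat \<Rightarrow> real) set \<Rightarrow> ((nat \<Rightarrow> real) \<Rightarrow> 'a) \<Rightarrow> ((nat \<Rightarrow> real) \<Rightarrow> 'a) \<Rightarrow> bool"
  where "f_equivalent Y f U p p' \<longleftrightarrow>
    (\<forall>u\<in>U. p u \<noteq> p' u \<longrightarrow> p u \<in> Y \<and> p' u \<in> Y \<and> f (p u) = f (p' u))"

definition f_invariant :: "'a diffeo_space \<Rightarrow> 'a set \<Rightarrow> ('a \<Rightarrow> 'b) \<Rightarrow> 'a form \<Rightarrow> bool"
  where "f_invariant X1 Y f \<omega> \<longleftrightarrow>
    (\<forall>n U p p'. (n, U, p) \<in> plots X1 \<longrightarrow> (n, U, p') \<in> plots X1 \<longrightarrow> f_equivalent Y f U p p' \<longrightarrow>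
       \<omega> (n, U, p) = \<omega> (n, U, p'))"

text \<open>The condition \<open>i\<^sup>*\<omega>\<^sub>1 = f\<^sup>*j\<^sup>*\<omega>\<^sub>2\<close>, where \<open>i\<close> and \<open>j\<close> are the inclusions of \<open>Y\<close> and \<open>f ` Y\<close>.\<close>

definition compatible ::
  "'a diffeo_space \<Rightarrow> 'b diffeo_space \<Rightarrow> 'a set \<Rightarrow> ('a \<Rightarrow> 'b) \<Rightarrow> 'a form \<Rightarrow> 'b form \<Rightarrow> bool"
  where "compatible X1 X2 Y f \<omega>1 \<omega>2 \<longleftrightarrow>
    pullback (subset_space X1 Y) (\<lambda>y. y) \<omega>1 =
    pullback (subset_space X1 Y) f (pullback (subset_space X2 (f ` Y)) (\<lambda>z. z) \<omega>2)"

definition Omega_comp ::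
  "nat \<Rightarrow> 'a diffeo_space \<Rightarrow> 'b diffeo_space \<Rightarrow> 'a set \<Rightarrow> ('a \<Rightarrow> 'b) \<Rightarrow>
   ('a form \<times> 'b form) diffeo_space"
  where "Omega_comp m X1 X2 Y f =
    subset_space (prod_space (Omega m X1) (Omega m X2))
      {(\<omega>1, \<omega>2). \<omega>1 \<in> forms m X1 \<and> \<omega>2 \<in> forms m X2 \<and>
         compatible X1 X2 Y f \<omega>1 \<omega>2 \<and> f_invariant X1 Y f \<omega>1}"

end

(*
  Split a form \<omega> on the gluing into its pullbacks along the two maps X1 -> G and X2 -> G. Every plot of
  G lifts locally, near each point of its domain, to a plot of X1 or of X2, so the pullbacks determine \<omega>.
  Conversely a pair (\<omega>1, \<omega>2) prescribes a value at each point of a plot through any such lift. Two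
  lifts to X1 are f-equivalent on the intersection of their domains, a lift q to X1 and a lift to X2
  differ by q |-> f o q with q valued in Y, and lifts to X2 are unique; so invariance and
  compatibility are exactly what makes the value independent of the lift. Smoothness, in both
  directions, is local and can be checked on lifts. That the product of the spaces of forms has the
  expected plots requires these spaces to be diffeological, which rests on the chain rule for C_infinity.
*)
theory Submission
  imports Defs
begin

subsection \<open>Calculus on domains\<close>

text \<open>Compatibility compares the two forms only along plots with values in \<open>Y\<close>.
  Two lifts of one plot of the gluing to \<open>X1\<close>, however, may differ at some points of
  \<open>Y\<close> and run outside \<open>Y\<close> at others, so their comparison is not a question
  about plots of \<open>Y\<close>; for this reason invariance is a condition on plots of
  \<open>X1\<close>. The factor \<open>X2\<close> behaves differently: as each point of
  \<open>Y\<close> is paired with a single point of \<open>X2\<close>, a class of the generated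
  equivalence contains at most one point of \<open>X2\<close>. The glued value is fixed at one point
  at a time, as a covector, since neighbouring points may call for lifts into different summands.
  Smoothness of functions is encoded by iterated partial derivatives, each taken in a single
  variable. No total derivative occurs in this encoding, so the chain rule is derived from the mean
  value theorem on the line. It is what keeps a family of covectors smooth after reparametrization,
  in particular along F x id on the product of a parameter domain and the domain of a plot.\<close>

lemma domain_iff_open: "openin (Euclidean_space n) U \<longleftrightarrow> (\<exists>T. open T \<and> U = Rn n \<inter> T)"
proof -
  have "Euclidean_space n = top_of_set (Rn n)"
    by (simp add: Euclidean_space_def euclidean_product_topology)
  then show ?thesis by (metis openin_open)
qed

lemma Rn_iff: "x \<in> Rn n \<longleftrightarrow> (\<forall>i\<ge>n. x i = 0)"
  by (simp add: topspace_Euclidean_space)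

lemma domain_in_Rn: "openin (Euclidean_space n) U \<Longrightarrow> u \<in> U \<Longrightarrow> u \<in> Rn n"
  using openin_subset by blast

lemma domain_zero: "openin (Euclidean_space n) U \<Longrightarrow> u \<in> U \<Longrightarrow> n \<le> i \<Longrightarrow> u i = 0"
  using domain_in_Rn Rn_iff by blast

lemma tendsto_coordinatewise:
  fixes c :: "'t \<Rightarrow> nat \<Rightarrow> real"
  assumes "\<And>i. ((\<lambda>t. c t i) \<longlongrightarrow> x i) F"
  shows "(c \<longlongrightarrow> x) F"
proof -
  have "limitin (product_topology (\<lambda>i. euclidean) UNIV) c x F"
    using assms by (simp add: limitin_componentwise)
  then show ?thesis by (simp add: euclidean_product_topology)
qed

lemma eventually_in_domain:
  assumes "openin (Euclidean_space n) U" "x \<in> U"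
    and "\<forall>\<^sub>F t in F. c t \<in> Rn n" "(c \<longlongrightarrow> x) F"
  shows "\<forall>\<^sub>F t in F. c t \<in> U"
proof -
  obtain T where T: "open T" "U = Rn n \<inter> T"
    using assms(1) by (auto simp: domain_iff_open)
  then have "\<forall>\<^sub>F t in F. c t \<in> T"
    using topological_tendstoD[OF assms(4) T(1)] assms(2) by simp
  with assms(3) show ?thesis by eventually_elim (simp add: T)
qed

text \<open>Failing radii 1/(k+1) would give points of \<open>Rn n\<close> outside \<open>U\<close>
  that tend to \<open>u\<close> in every coordinate, hence in the product topology, against the
  openness of \<open>U\<close>. Boxes suit the chain rule, which moves one coordinate at a
  time.\<close>

lemma domain_contains_box:
  assumes U: "openin (Euclidean_space n) U" "u \<in> U"
  obtains e where "e > 0" "\<And>x. x \<in> Rn n \<Longrightarrow> (\<And>i. i < n \<Longrightarrow> \<bar>x i - u i\<bar> < e) \<Longrightarrow> x \<in> U"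
proof (rule ccontr)
  assume "\<not> thesis"
  then have "\<exists>x. x \<in> Rn n \<and> (\<forall>i<n. \<bar>x i - u i\<bar> < inverse (real (Suc k))) \<and> x \<notin> U" for k
    using that[of "inverse (real (Suc k))"] by auto
  then obtain x where x: "\<And>k. x k \<in> Rn n" "\<And>k i. i < n \<Longrightarrow> \<bar>x k i - u i\<bar> < inverse (real (Suc k))"
    "\<And>k. x k \<notin> U" by metis
  have "(\<lambda>k. x k i) \<longlonglongrightarrow> u i" for i
  proof (cases "i < n")
    case True
    have "(\<lambda>k. x k i - u i) \<longlonglongrightarrow> 0"
    proof (rule Lim_null_comparison[OF always_eventually LIMSEQ_inverse_real_of_nat], rule allI)
      show "norm (x k i - u i) \<le> inverse (real (Suc k))" for k
        using x(2)[OF True, of k] unfolding real_norm_def by (rule less_imp_le)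
    qed
    then show ?thesis by (rule LIM_zero_cancel)
  next
    case False
    then show ?thesis using x(1) domain_zero[OF U] by (simp add: Rn_iff)
  qed
  then have "x \<longlonglongrightarrow> u" by (rule tendsto_coordinatewise)
  then have "\<forall>\<^sub>F k in sequentially. x k \<in> U"
    using U x(1) by (intro eventually_in_domain) auto
  then show False using x(3) by simp
qed

lemma fun_upd_in_Rn: "x \<in> Rn n \<Longrightarrow> j < n \<Longrightarrow> x(j := t) \<in> Rn n"
  by (auto simp: Rn_iff)

lemma eventually_slice_in_domain:
  assumes "openin (Euclidean_space n) U" "u \<in> U" "j < n"
  shows "\<forall>\<^sub>F t in nhds (u j). u(j := t) \<in> U"
proof (rule eventually_in_domain[OF assms(1,2)])
  show "\<forall>\<^sub>F t in nhds (u j). u(j := t) \<in> Rn n"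
    using assms domain_in_Rn fun_upd_in_Rn by (simp add: always_eventually)
  show "((\<lambda>t. u(j := t)) \<longlongrightarrow> u) (nhds (u j))"
  proof (rule tendsto_coordinatewise)
    show "((\<lambda>t. (u(j := t)) i) \<longlongrightarrow> u i) (nhds (u j))" for i
      by (cases "i = j") (simp_all add: filterlim_ident)
  qed
qed

section \<open>Closure properties of the classes C^k on a domain\<close>

lemma C_diff_Suc_D:
  assumes "C_diff (Suc k) n U g" "j < n"
  shows "u \<in> U \<Longrightarrow> ((\<lambda>t. g (u(j := t))) has_field_derivative partial j g u) (at (u j))"
    and "C_diff k n U (partial j g)"
  using assms by (auto simp: partial_def DERIV_deriv_iff_field_differentiable)

lemma C_diff_continuous: "C_diff k n U g \<Longrightarrow> continuous_on U g"
  by (cases k) auto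

text \<open>\<open>partial\<close> evaluates its function on a whole slice, also outside
  \<open>U\<close>. As \<open>U\<close> is open, the slice through \<open>u\<close> stays in
  \<open>U\<close> for \<open>t\<close> near \<open>u j\<close>, so equality on \<open>U\<close>
  determines the derivatives there and passes on to the partial derivatives.\<close>

lemma C_diff_cong:
  assumes "openin (Euclidean_space n) U" "C_diff k n U g" "\<And>u. u \<in> U \<Longrightarrow> g u = h u"
  shows "C_diff k n U h"
  using assms(2,3)
proof (induction k arbitrary: g h)
  case 0
  then show ?case by (simp cong: continuous_on_cong)
next
  case (Suc k)
  have ev: "\<forall>\<^sub>F t in nhds (u j). g (u(j := t)) = h (u(j := t))" if "j < n" "u \<in> U" for j u
    using eventually_slice_in_domain[OF assms(1) that(2,1)] by eventually_elim (rule Suc.prems(2))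
  have D: "((\<lambda>t. h (u(j := t))) has_field_derivative partial j g u) (at (u j))"
    if "j < n" "u \<in> U" for j u
    using DERIV_cong_ev[OF refl ev[OF that] refl] C_diff_Suc_D(1)[OF Suc.prems(1) that] by blast
  have "C_diff k n U (partial j h)" if "j < n" for j
  proof (rule Suc.IH)
    show "C_diff k n U (partial j g)" using Suc.prems(1) that by simp
    show "partial j g u = partial j h u" if "u \<in> U" for u
      using DERIV_imp_deriv[OF D[OF \<open>j < n\<close> that]] by (simp add: partial_def[of j h])
  qed
  moreover have "continuous_on U h"
    using C_diff_continuous[OF Suc.prems(1)] Suc.prems(2) by (simp cong: continuous_on_cong)
  ultimately show ?case using D by (auto simp: field_differentiable_def)
qed

text \<open>\<open>partial\<close> is a \<open>deriv\<close> and awkward to compute for composite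
  expressions. Any family \<open>g'\<close> of derivatives on \<open>U\<close> can stand in for it:
  it agrees with \<open>partial j g\<close> on \<open>U\<close>, which suffices by
  \<open>C_diff_cong\<close>.\<close>

lemma C_diff_SucI:
  assumes U: "openin (Euclidean_space n) U" and "continuous_on U g"
    and D: "\<And>j u. j < n \<Longrightarrow> u \<in> U \<Longrightarrow> ((\<lambda>t. g (u(j := t))) has_field_derivative g' j u) (at (u j))"
    and C: "\<And>j. j < n \<Longrightarrow> C_diff k n U (g' j)"
  shows "C_diff (Suc k) n U g"
proof -
  have "C_diff k n U (partial j g)" if "j < n" for j
    by (rule C_diff_cong[OF U C[OF that]])
       (use D[OF that, THEN DERIV_imp_deriv] in \<open>simp add: partial_def\<close>)
  with assms(2) D show ?thesis by (auto simp: field_differentiable_def)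
qed

lemma C_diff_lower: "C_diff (Suc k) n U g \<Longrightarrow> C_diff k n U g"
  by (induction k arbitrary: g) auto

lemma C_diff_subset: "C_diff k n U g \<Longrightarrow> V \<subseteq> U \<Longrightarrow> C_diff k n V g"
  by (induction k arbitrary: g) (auto intro: continuous_on_subset)

lemma C_diff_local:
  assumes "openin (Euclidean_space n) U"
    and "\<And>u. u \<in> U \<Longrightarrow> \<exists>V. openin (Euclidean_space n) V \<and> u \<in> V \<and> C_diff k n V g"
  shows "C_diff k n U g"
proof -
  have cont: "continuous_on U g"
    if loc: "\<And>u. u \<in> U \<Longrightarrow> \<exists>V. openin (Euclidean_space n) V \<and> u \<in> V \<and> C_diff k n V g" for k g
    unfolding continuous_on_eq_continuous_within
  proof
    fix u assume u: "u \<in> U"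
    with loc obtain V where V: "openin (Euclidean_space n) V" "u \<in> V" "C_diff k n V g" by blast
    obtain S T where "open S" "U = Rn n \<inter> S" "open T" "V = Rn n \<inter> T"
      using assms(1) V(1) by (auto simp: domain_iff_open)
    \<comment> \<open>Both domains are traces on \<open>Rn n\<close> of open sets and coincide
      inside \<open>S \<inter> T\<close>, so they define the same limits at
      \<open>u\<close>.\<close>
    then have "at u within U = at u within V"
      using u V(2) by (intro at_within_nhd[of u "S \<inter> T"]) auto
    then show "continuous (at u within U) g"
      using C_diff_continuous[OF V(3)] V(2) by (simp add: continuous_on_eq_continuous_within)
  qed
  show ?thesis using assms(2)
  proof (induction k arbitrary: g)
    case 0
    then show ?case using cont[of 0] by simp
  next
    case (Suc k)
    have "C_diff k n U (partial j g)" if "j < n" for j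
      using Suc.prems that by (intro Suc.IH) (meson C_diff_Suc_D(2))
    moreover have "(\<lambda>t. g (u(j := t))) field_differentiable at (u j)" if "j < n" "u \<in> U" for j u
      using Suc.prems[OF that(2)] that(1) by auto
    ultimately show ?case using cont[OF Suc.prems] by auto
  qed
qed

lemma C_diff_const:
  assumes U: "openin (Euclidean_space n) U"
  shows "C_diff k n U (\<lambda>u. c)"
proof (induction k arbitrary: c)
  case (Suc k)
  then show ?case by (intro C_diff_SucI[OF U, where g' = "\<lambda>_ _. 0"]) simp_all
qed simp

lemma C_diff_coordinate:
  assumes U: "openin (Euclidean_space n) U"
  shows "C_diff k n U (\<lambda>u. u i)"
proof -
  have cont: "continuous_on U (\<lambda>u. u i)"
    by (rule continuous_on_product_then_coordinatewise[OF continuous_on_id])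
  show ?thesis
  proof (cases k)
    case (Suc k')
    have "((\<lambda>t. (u(j := t)) i) has_field_derivative (if i = j then 1 else 0)) (at (u j))"
      for u :: "nat \<Rightarrow> real" and j
      by (auto intro: derivative_eq_intros)
    then show ?thesis unfolding Suc
      by (intro C_diff_SucI[OF U cont]) (auto intro: C_diff_const[OF U])
  qed (simp add: cont)
qed

lemma C_diff_add:
  assumes U: "openin (Euclidean_space n) U"
  shows "C_diff k n U g \<Longrightarrow> C_diff k n U h \<Longrightarrow> C_diff k n U (\<lambda>u. g u + h u)"
proof (induction k arbitrary: g h)
  case (Suc k)
  show ?case
    using Suc.prems[THEN C_diff_continuous] C_diff_Suc_D[OF Suc.prems(1)] C_diff_Suc_D[OF Suc.prems(2)]
    by (intro C_diff_SucI[OF U, where g' = "\<lambda>j u. partial j g u + partial j h u"])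
       (auto intro!: continuous_on_add Suc.IH DERIV_add)
qed (auto intro: continuous_on_add)

text \<open>Induction over all pairs of factors at once: each summand of the product rule multiplies
  a partial derivative of one factor, of class C^k, by the other factor, lowered from C^(k+1) to
  C^k.\<close>

lemma C_diff_mult:
  assumes U: "openin (Euclidean_space n) U"
  shows "C_diff k n U g \<Longrightarrow> C_diff k n U h \<Longrightarrow> C_diff k n U (\<lambda>u. g u * h u)"
proof (induction k arbitrary: g h)
  case (Suc k)
  have D: "((\<lambda>t. g (u(j := t)) * h (u(j := t))) has_field_derivative
      partial j g u * h u + partial j h u * g u) (at (u j))" if "j < n" "u \<in> U" for j u
    using DERIV_mult[OF C_diff_Suc_D(1)[OF Suc.prems(1) that] C_diff_Suc_D(1)[OF Suc.prems(2) that]]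
    by (simp only: fun_upd_triv)
  show ?case
    using Suc.prems[THEN C_diff_continuous] Suc.prems[THEN C_diff_lower]
      C_diff_Suc_D(2)[OF Suc.prems(1)] C_diff_Suc_D(2)[OF Suc.prems(2)]
    by (intro C_diff_SucI[OF U _ D])
       (auto intro!: continuous_on_mult Suc.IH C_diff_add[OF U])
qed (auto intro: continuous_on_mult)

lemma C_diff_sum:
  assumes "openin (Euclidean_space n) U" "\<And>i. i \<in> I \<Longrightarrow> C_diff k n U (g i)"
  shows "C_diff k n U (\<lambda>u. \<Sum>i\<in>I. g i u)"
  using assms(2)
  by (induction I rule: infinite_finite_induct) (auto intro: C_diff_const C_diff_add assms(1))

section \<open>The chain rule\<close>

lemma MVT_closed_segment:
  fixes g :: "real \<Rightarrow> real"
  assumes "\<And>x. x \<in> closed_segment a b \<Longrightarrow> (g has_field_derivative g' x) (at x)"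
  obtains x where "x \<in> closed_segment a b" "g b - g a = g' x * (b - a)"
proof -
  \<comment> \<open>The moving coordinate of a curve may lie on either side of its base value or
    coincide with it; in the last case both sides of the identity vanish.\<close>
  consider "a < b" | "a = b" | "b < a" by linarith
  then show thesis
  proof cases
    case 1
    then obtain x where "a < x" "x < b" "g b - g a = (b - a) * g' x"
      using MVT2[OF 1, of g g'] assms by (auto simp: closed_segment_eq_real_ivl)
    with 1 that[of x] show thesis by (simp add: closed_segment_eq_real_ivl mult.commute)
  next
    case 2
    then show thesis using that by simp
  next
    case 3
    then obtain x where "b < x" "x < a" "g a - g b = (a - b) * g' x"
      using MVT2[OF 3, of g g'] assms by (auto simp: closed_segment_eq_real_ivl)
    with 3 that[of x] show thesis by (simp add: closed_segment_eq_real_ivl algebra_simps)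
  qed
qed

text \<open>
  Moving from \<open>c t0\<close> to \<open>c t\<close> one coordinate at a time through the points \<open>z i t\<close>, each step is
  controlled by the mean value theorem in a single variable.
\<close>

lemma chain_rule_curve:
  assumes U: "openin (Euclidean_space n) U" and g: "C_diff (Suc 0) n U g"
    and c: "\<And>t. c t \<in> Rn n" "c t0 \<in> U"
    and D: "\<And>i. i < n \<Longrightarrow> ((\<lambda>t. c t i) has_field_derivative d i) (at t0)"
  shows "((\<lambda>t. g (c t)) has_field_derivative (\<Sum>i<n. partial i g (c t0) * d i)) (at t0)"
proof -
  define z where "z i t = (\<lambda>l. if l < i then c t l else c t0 l)" for i t
  have lim: "((\<lambda>t. c t i) \<longlongrightarrow> c t0 i) (at t0)" for i
  proof (cases "i < n")
    case True
    then show ?thesis using DERIV_isCont[OF D] isCont_def by blast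
  next
    case False
    then show ?thesis using c(1) by (simp add: Rn_iff)
  qed
  obtain e where e: "e > 0" "\<And>x. x \<in> Rn n \<Longrightarrow> (\<And>i. i < n \<Longrightarrow> \<bar>x i - c t0 i\<bar> < e) \<Longrightarrow> x \<in> U"
    using domain_contains_box[OF U c(2)] by blast
  have near: "\<forall>\<^sub>F t in at t0. \<forall>i\<in>{..<n}. \<bar>c t i - c t0 i\<bar> < e"
    using tendstoD[OF lim e(1)] by (intro eventually_ball_finite) (auto simp: dist_real_def)
  have step: "((\<lambda>t. (g (z (Suc i) t) - g (z i t)) / (t - t0)) \<longlongrightarrow> partial i g (c t0) * d i) (at t0)"
    if i: "i < n" for i
  proof -
    let ?P = "\<lambda>t \<xi>. \<xi> \<in> closed_segment (c t0 i) (c t i) \<and> (z i t)(i := \<xi>) \<in> U \<and>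
        g (z (Suc i) t) - g (z i t) = partial i g ((z i t)(i := \<xi>)) * (c t i - c t0 i)"
    have "\<forall>\<^sub>F t in at t0. \<exists>\<xi>. ?P t \<xi>"
      using near
    proof eventually_elim
      case (elim t)
      \<comment> \<open>Coordinates below \<open>i\<close> are those of \<open>c t\<close>,
        coordinates above \<open>i\<close> those of \<open>c t0\<close>, and the \<open>i\<close>-th
        lies between the two, so the whole segment is in the box around \<open>c t0\<close>.\<close>
      have seg: "(z i t)(i := \<xi>) \<in> U" if "\<xi> \<in> closed_segment (c t0 i) (c t i)" for \<xi>
      proof (rule e(2))
        show "(z i t)(i := \<xi>) \<in> Rn n" using i c(1) by (auto simp: z_def Rn_iff)
        have "\<bar>\<xi> - c t0 i\<bar> \<le> \<bar>c t i - c t0 i\<bar>"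
          using that by (auto simp: closed_segment_eq_real_ivl split: if_splits)
        then show "\<bar>((z i t)(i := \<xi>)) l - c t0 l\<bar> < e" if "l < n" for l
          using elim that i e(1) by (auto simp: z_def intro: le_less_trans)
      qed
      have "((\<lambda>s. g ((z i t)(i := s))) has_field_derivative partial i g ((z i t)(i := \<xi>))) (at \<xi>)"
        if "\<xi> \<in> closed_segment (c t0 i) (c t i)" for \<xi>
        using C_diff_Suc_D(1)[OF g i seg[OF that]] by simp
      then obtain \<xi> where "\<xi> \<in> closed_segment (c t0 i) (c t i)"
        "g ((z i t)(i := c t i)) - g ((z i t)(i := c t0 i)) =
          partial i g ((z i t)(i := \<xi>)) * (c t i - c t0 i)"
        by (rule MVT_closed_segment)
      moreover have "(z i t)(i := c t i) = z (Suc i) t" "(z i t)(i := c t0 i) = z i t"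
        by (auto simp: z_def fun_eq_iff less_Suc_eq)
      ultimately show ?case using seg by auto
    qed
    \<comment> \<open>Choice makes the intermediate point a function of \<open>t\<close>, so that
      limits in \<open>t\<close> can be taken. Its value is arbitrary where no such point exists,
      which does not happen for \<open>t\<close> close to \<open>t0\<close>.\<close>
    then have P: "\<forall>\<^sub>F t in at t0. ?P t (SOME \<xi>. ?P t \<xi>)"
      by eventually_elim (rule someI_ex)
    define \<xi> where "\<xi> t = (SOME \<xi>. ?P t \<xi>)" for t
    have P: "\<forall>\<^sub>F t in at t0. ?P t (\<xi> t)" using P by (simp add: \<xi>_def)
    have "((\<lambda>t. \<xi> t - c t0 i) \<longlongrightarrow> 0) (at t0)"
    proof (rule Lim_null_comparison)
      show "\<forall>\<^sub>F t in at t0. norm (\<xi> t - c t0 i) \<le> \<bar>c t i - c t0 i\<bar>"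
        using P by eventually_elim (auto simp: closed_segment_eq_real_ivl split: if_splits)
      show "((\<lambda>t. \<bar>c t i - c t0 i\<bar>) \<longlongrightarrow> 0) (at t0)"
        using lim[of i] by (simp add: LIM_zero tendsto_rabs_zero)
    qed
    then have "(\<xi> \<longlongrightarrow> c t0 i) (at t0)" by (rule LIM_zero_cancel)
    then have zlim: "((\<lambda>t. (z i t)(i := \<xi> t)) \<longlongrightarrow> c t0) (at t0)"
    proof (intro tendsto_coordinatewise)
      show "((\<lambda>t. ((z i t)(i := \<xi> t)) l) \<longlongrightarrow> c t0 l) (at t0)" if "(\<xi> \<longlongrightarrow> c t0 i) (at t0)" for l
        using that lim[of l] by (cases "l = i"; cases "l < i") (simp_all add: z_def)
    qed
    have cont: "continuous_on U (partial i g)" using g i by simp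
    have "((\<lambda>t. partial i g ((z i t)(i := \<xi> t))) \<longlongrightarrow> partial i g (c t0)) (at t0)"
    proof (rule continuous_on_tendsto_compose[OF cont zlim c(2)])
      show "\<forall>\<^sub>F t in at t0. (z i t)(i := \<xi> t) \<in> U"
        using P by eventually_elim blast
    qed
    moreover have "((\<lambda>t. (c t i - c t0 i) / (t - t0)) \<longlongrightarrow> d i) (at t0)"
      using D[OF i] by (simp add: has_field_derivative_iff)
    ultimately have "((\<lambda>t. partial i g ((z i t)(i := \<xi> t)) * ((c t i - c t0 i) / (t - t0)))
        \<longlongrightarrow> partial i g (c t0) * d i) (at t0)"
      by (rule tendsto_mult)
    then show ?thesis
      by (rule Lim_transform_eventually) (use P in \<open>auto elim: eventually_mono\<close>)
  qed
  \<comment> \<open>The chain of intermediate points really ends at \<open>c t\<close>, because the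
    coordinates from \<open>n\<close> on vanish for \<open>c t\<close> and \<open>c t0\<close>
    alike. Hence the increments telescope.\<close>
  have z: "z 0 t = c t0" "z n t = c t" for t
    using c(1) by (auto simp: z_def fun_eq_iff Rn_iff)
  have "(\<Sum>i<n. (g (z (Suc i) t) - g (z i t)) / (t - t0)) = (g (c t) - g (c t0)) / (t - t0)" for t
    using sum_lessThan_telescope[of "\<lambda>i. g (z i t)" n] by (simp add: z flip: sum_divide_distrib)
  moreover have "((\<lambda>t. \<Sum>i<n. (g (z (Suc i) t) - g (z i t)) / (t - t0))
      \<longlongrightarrow> (\<Sum>i<n. partial i g (c t0) * d i)) (at t0)"
    by (intro tendsto_sum step) simp
  ultimately show ?thesis by (simp add: has_field_derivative_iff)
qed

text \<open>The induction fixes \<open>F\<close> and varies \<open>g\<close>: by the chain rule a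
  partial derivative of the composite is a sum of terms \<open>partial i g (F u)\<close>, covered by
  the induction hypothesis for \<open>partial i g\<close>, times partial derivatives of
  \<open>F\<close>.\<close>

lemma C_diff_compose:
  assumes U': "openin (Euclidean_space n') U'" and U: "openin (Euclidean_space n) U"
    and F: "F \<in> U' \<rightarrow> U"
  shows "C_diff k n U g \<Longrightarrow> (\<And>i. i < n \<Longrightarrow> C_diff k n' U' (\<lambda>u. F u i)) \<Longrightarrow> C_diff k n' U' (\<lambda>u. g (F u))"
proof (induction k arbitrary: g)
  have cont: "continuous_on U' (\<lambda>u. g (F u))"
    if g: "continuous_on U g" and Fi: "\<And>i. i < n \<Longrightarrow> continuous_on U' (\<lambda>u. F u i)" for g :: "_ \<Rightarrow> real"
  proof -
    have "continuous_on U' (\<lambda>u. F u i)" for i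
    proof (cases "i < n")
      case False
      have "continuous_on U' (\<lambda>u. 0 :: real)" by simp
      moreover have "F u i = 0" if "u \<in> U'" for u
        using F that False domain_zero[OF U, of "F u" i] by auto
      ultimately show ?thesis by (simp cong: continuous_on_cong)
    qed (rule Fi)
    then have "continuous_on U' F" by (rule continuous_on_coordinatewise_then_product)
    then show ?thesis using continuous_on_compose2[OF g] F by blast
  qed
  {
    case 0
    then show ?case using cont by simp
  next
    case (Suc k)
    have D: "((\<lambda>t. g (F (u(j := t)))) has_field_derivative
        (\<Sum>i<n. partial i g (F u) * partial j (\<lambda>x. F x i) u)) (at (u j))"
      if j: "j < n'" and u: "u \<in> U'" for j u
    proof -
      \<comment> \<open>The default value 0 where the slice leaves \<open>U'\<close> keeps
        \<open>c t\<close> in \<open>Rn n\<close> for every \<open>t\<close>, as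
        \<open>chain_rule_curve\<close> demands. Near \<open>u j\<close> the slice is inside
        \<open>U'\<close>, so the derivative is not affected.\<close>
      define c where "c t = (if u(j := t) \<in> U' then F (u(j := t)) else (\<lambda>_. 0))" for t
      have Fu: "F (u(j := u j)) \<in> U" using F u by auto
      have c0: "c (u j) = F u" using u by (simp add: c_def)
      have ev: "\<forall>\<^sub>F t in nhds (u j). c t = F (u(j := t))"
        using eventually_slice_in_domain[OF U' u j] by eventually_elim (simp add: c_def)
      have "((\<lambda>t. g (c t)) has_field_derivative
          (\<Sum>i<n. partial i g (c (u j)) * partial j (\<lambda>x. F x i) u)) (at (u j))"
      proof (rule chain_rule_curve[OF U])
        show "C_diff (Suc 0) n U g"
          using Suc.prems(1) C_diff_continuous[OF C_diff_Suc_D(2)[OF Suc.prems(1)]] by simp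
        show "c t \<in> Rn n" for t
          using F domain_in_Rn[OF U] by (auto simp: c_def Rn_iff)
        show "c (u j) \<in> U" using Fu c0 by simp
        fix i assume i: "i < n"
        have "\<forall>\<^sub>F t in nhds (u j). F (u(j := t)) i = c t i"
          using ev by eventually_elim simp
        from iffD1[OF DERIV_cong_ev[OF refl this refl] C_diff_Suc_D(1)[OF Suc.prems(2)[OF i] j u]]
        show "((\<lambda>t. c t i) has_field_derivative partial j (\<lambda>x. F x i) u) (at (u j))" .
      qed
      moreover have "\<forall>\<^sub>F t in nhds (u j). g (c t) = g (F (u(j := t)))"
        using ev by eventually_elim simp
      ultimately show ?thesis
        by (subst DERIV_cong_ev[OF refl _ refl, symmetric]) (simp_all add: c0)
    qed
    show ?case
    proof (rule C_diff_SucI[OF U' _ D])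
      show "continuous_on U' (\<lambda>u. g (F u))"
        by (rule cont[OF C_diff_continuous[OF Suc.prems(1)] C_diff_continuous[OF Suc.prems(2)]])
      show "C_diff k n' U' (\<lambda>u. \<Sum>i<n. partial i g (F u) * partial j (\<lambda>x. F x i) u)"
        if "j < n'" for j
      proof (rule C_diff_sum[OF U'])
        fix i assume "i \<in> {..<n}"
        then have i: "i < n" by simp
        have "C_diff k n' U' (\<lambda>u. partial i g (F u))"
          by (rule Suc.IH[OF C_diff_Suc_D(2)[OF Suc.prems(1) i] C_diff_lower[OF Suc.prems(2)]])
        then show "C_diff k n' U' (\<lambda>u. partial i g (F u) * partial j (\<lambda>x. F x i) u)"
          by (rule C_diff_mult[OF U' _ C_diff_Suc_D(2)[OF Suc.prems(2)[OF i] that]])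
      qed
    qed
  }
qed

subsection \<open>Smooth maps and families of covectors\<close>

lemma C_infinity_cong:
  "openin (Euclidean_space n) U \<Longrightarrow> C_infinity n U g \<Longrightarrow> (\<And>u. u \<in> U \<Longrightarrow> g u = h u) \<Longrightarrow> C_infinity n U h"
  unfolding C_infinity_def by (meson C_diff_cong)

lemma C_infinity_subset: "C_infinity n U g \<Longrightarrow> V \<subseteq> U \<Longrightarrow> C_infinity n V g"
  unfolding C_infinity_def by (meson C_diff_subset)

lemma C_infinity_local:
  assumes "openin (Euclidean_space n) U"
    and "\<And>u. u \<in> U \<Longrightarrow> \<exists>V. openin (Euclidean_space n) V \<and> u \<in> V \<and> C_infinity n V g"
  shows "C_infinity n U g"
  using assms unfolding C_infinity_def by (meson C_diff_local)

lemma C_infinity_coordinate: "openin (Euclidean_space n) U \<Longrightarrow> C_infinity n U (\<lambda>u. u i)"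
  unfolding C_infinity_def by (simp add: C_diff_coordinate)

lemma C_infinity_compose:
  "smooth_between n' U' n U F \<Longrightarrow> C_infinity n U g \<Longrightarrow> C_infinity n' U' (\<lambda>u. g (F u))"
  unfolding C_infinity_def smooth_between_def by (blast intro: C_diff_compose)

lemma smooth_between_mem: "smooth_between n' U' n U F \<Longrightarrow> u \<in> U' \<Longrightarrow> F u \<in> U"
  by (auto simp: smooth_between_def)

lemma smooth_between_open:
  assumes "smooth_between n' U' n U F"
  shows "openin (Euclidean_space n') U'" "openin (Euclidean_space n) U"
  using assms by (simp_all add: smooth_between_def)

lemma smooth_between_continuous:
  assumes "smooth_between n' U' n U F"
  shows "continuous_on U' F"
proof (rule continuous_on_coordinatewise_then_product)
  fix i
  show "continuous_on U' (\<lambda>u. F u i)"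
  proof (cases "i < n")
    case True
    have "C_diff 0 n' U' (\<lambda>u. F u i)"
      using assms True unfolding smooth_between_def C_infinity_def by blast
    then show ?thesis by (rule C_diff_continuous)
  next
    case False
    have "F u i = 0" if "u \<in> U'" for u
      using domain_zero[OF smooth_between_open(2)[OF assms] smooth_between_mem[OF assms that]] False
      by simp
    then show ?thesis using continuous_on_cong[of U' U' "\<lambda>u. F u i" "\<lambda>_. 0"] by simp
  qed
qed

lemma smooth_between_vimage_open:
  assumes F: "smooth_between n' U' n U F" and V: "openin (Euclidean_space n) V"
  shows "openin (Euclidean_space n') {u \<in> U'. F u \<in> V}"
proof -
  obtain S T where S: "open S" "U' = Rn n' \<inter> S" and T: "open T" "V = Rn n \<inter> T"
    using smooth_between_open(1)[OF F] V by (auto simp: domain_iff_open)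
  obtain A where A: "open A" "A \<inter> U' = F -` T \<inter> U'"
    using smooth_between_continuous[OF F] T(1) unfolding continuous_on_open_invariant by blast
  have "F u \<in> Rn n" if "u \<in> U'" for u
    using domain_in_Rn[OF smooth_between_open(2)[OF F] smooth_between_mem[OF F that]] .
  then have "{u \<in> U'. F u \<in> V} = A \<inter> U'" unfolding A(2) T(2) by blast
  also have "\<dots> = Rn n' \<inter> (S \<inter> A)" unfolding S(2) by blast
  finally show ?thesis unfolding domain_iff_open using open_Int[OF S(1) A(1)] by blast
qed

lemma smooth_between_restrict:
  assumes F: "smooth_between n' U' n U F" and V: "openin (Euclidean_space n) V"
    and W: "openin (Euclidean_space n') W" "W \<subseteq> U'" "F \<in> W \<rightarrow> V"
  shows "smooth_between n' W n V F"
  using assms C_infinity_subset[OF _ W(2)] by (simp add: smooth_between_def)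

lemma smooth_between_inclusion:
  assumes "openin (Euclidean_space n) U" "openin (Euclidean_space n) V" "V \<subseteq> U"
  shows "smooth_between n V n U (\<lambda>x. x)"
  using assms C_infinity_coordinate by (auto simp: smooth_between_def)

lemma partial_coordinate: "partial j (\<lambda>x. x i) u = (if i = j then 1 else 0)"
proof -
  have "((\<lambda>t. (u(j := t)) i) has_field_derivative (if i = j then 1 else 0)) (at (u j))"
    by (auto intro: derivative_eq_intros)
  then show ?thesis unfolding partial_def by (rule DERIV_imp_deriv)
qed

text \<open>The Jacobian matrix is the identity, but the sum defining \<open>differential\<close>
  stops at \<open>n\<close>; for \<open>v\<close> in \<open>Rn n\<close> the remaining coordinates
  are zero on both sides.\<close>

lemma differential_ident: "v \<in> Rn n \<Longrightarrow> differential n (\<lambda>x. x) u v = v"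
  by (auto simp: differential_def partial_coordinate Rn_iff fun_eq_iff if_distrib[of "\<lambda>a. a * _"]
      cong: if_cong)

lemma smooth_to_covectors_cong:
  assumes "openin (Euclidean_space k) W" "smooth_to_covectors m n k W \<eta>"
    and "\<And>w. w \<in> W \<Longrightarrow> \<eta> w = \<eta>' w"
  shows "smooth_to_covectors m n k W \<eta>'"
  unfolding smooth_to_covectors_def
proof (intro conjI ballI)
  show "\<eta>' w \<in> covectors m n" if "w \<in> W" for w
    using assms that by (auto simp: smooth_to_covectors_def)
  show "C_infinity k W (\<lambda>w. \<eta>' w vs)" if "vs \<in> vector_tuples m n" for vs
    by (rule C_infinity_cong[OF assms(1), of "\<lambda>w. \<eta> w vs"])
       (use assms that in \<open>auto simp: smooth_to_covectors_def\<close>)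
qed

lemma smooth_to_covectors_local:
  assumes "openin (Euclidean_space k) W"
    and loc: "\<And>w. w \<in> W \<Longrightarrow>
      \<exists>V. openin (Euclidean_space k) V \<and> w \<in> V \<and> smooth_to_covectors m n k V \<eta>"
  shows "smooth_to_covectors m n k W \<eta>"
  unfolding smooth_to_covectors_def
proof (intro conjI ballI)
  show "\<eta> w \<in> covectors m n" if "w \<in> W" for w
    using loc[OF that] by (auto simp: smooth_to_covectors_def)
  show "C_infinity k W (\<lambda>w. \<eta> w vs)" if "vs \<in> vector_tuples m n" for vs
    by (rule C_infinity_local[OF assms(1)])
       (use loc that in \<open>unfold smooth_to_covectors_def, blast\<close>)
qed

lemma smooth_to_covectors_compose:
  assumes "smooth_between k' W' k W H" "smooth_to_covectors m n k W \<eta>"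
  shows "smooth_to_covectors m n k' W' (\<lambda>w. \<eta> (H w))"
  unfolding smooth_to_covectors_def
proof (intro conjI ballI)
  show "\<eta> (H w) \<in> covectors m n" if "w \<in> W'" for w
    using assms(2) smooth_between_mem[OF assms(1) that] by (simp add: smooth_to_covectors_def)
  show "C_infinity k' W' (\<lambda>w. \<eta> (H w) vs)" if "vs \<in> vector_tuples m n" for vs
    by (rule C_infinity_compose[OF assms(1), of "\<lambda>w. \<eta> w vs"])
       (use assms(2) that in \<open>simp add: smooth_to_covectors_def\<close>)
qed

subsection \<open>Diffeologies generated by families of plots\<close>

lemma diffeologyD:
  assumes "diffeology A D"
  shows diffeology_param: "(n, U, p) \<in> D \<Longrightarrow> openin (Euclidean_space n) U"
      "(n, U, p) \<in> D \<Longrightarrow> p \<in> U \<rightarrow>\<^sub>E A"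
    and diffeology_const: "openin (Euclidean_space n) U \<Longrightarrow> x \<in> A \<Longrightarrow> (n, U, \<lambda>u\<in>U. x) \<in> D"
    and diffeology_compose: "(n, U, p) \<in> D \<Longrightarrow> smooth_between n' U' n U F \<Longrightarrow>
      (n', U', compose U' p F) \<in> D"
    and diffeology_local: "openin (Euclidean_space n) U \<Longrightarrow> p \<in> U \<rightarrow>\<^sub>E A \<Longrightarrow>
      (\<And>u. u \<in> U \<Longrightarrow> \<exists>V. openin (Euclidean_space n) V \<and> u \<in> V \<and> V \<subseteq> U \<and> (n, V, restrict p V) \<in> D) \<Longrightarrow>
      (n, U, p) \<in> D"
proof -
  note A = assms[unfolded diffeology_def parametrizations_def]
  show "(n, U, p) \<in> D \<Longrightarrow> openin (Euclidean_space n) U" "(n, U, p) \<in> D \<Longrightarrow> p \<in> U \<rightarrow>\<^sub>E A"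
    using conjunct1[OF A] by blast+
  show "openin (Euclidean_space n) U \<Longrightarrow> x \<in> A \<Longrightarrow> (n, U, \<lambda>u\<in>U. x) \<in> D"
    using A by blast
  show "(n, U, p) \<in> D \<Longrightarrow> smooth_between n' U' n U F \<Longrightarrow> (n', U', compose U' p F) \<in> D"
    using A by blast
  show "openin (Euclidean_space n) U \<Longrightarrow> p \<in> U \<rightarrow>\<^sub>E A \<Longrightarrow>
      (\<And>u. u \<in> U \<Longrightarrow> \<exists>V. openin (Euclidean_space n) V \<and> u \<in> V \<and> V \<subseteq> U \<and> (n, V, restrict p V) \<in> D) \<Longrightarrow>
      (n, U, p) \<in> D"
    using A[THEN conjunct2, THEN conjunct2, THEN conjunct2, rule_format, of n U p] by simp
qed

lemma compose_ident: "compose V p (\<lambda>x. x) = restrict p V"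
  by (simp add: compose_def)

lemma diffeology_restrict:
  assumes "diffeology A D" "(n, U, p) \<in> D" "openin (Euclidean_space n) V" "V \<subseteq> U"
  shows "(n, V, restrict p V) \<in> D"
  using diffeology_compose[OF assms(1,2) smooth_between_inclusion[OF diffeology_param(1)[OF assms(1,2)] assms(3,4)]]
  by (simp add: compose_ident)

text \<open>For a family that contains the constants and is stable under reparametrization, this is
  the diffeology it generates. It provides the explicit value of the \<open>LEAST\<close> in
  quotients and sums.\<close>

definition locally_in :: "'a set \<Rightarrow> 'a plot set \<Rightarrow> 'a plot set"
  where "locally_in A G = {(n, U, p). (n, U, p) \<in> parametrizations A \<and>
    (\<forall>u\<in>U. \<exists>V. openin (Euclidean_space n) V \<and> u \<in> V \<and> V \<subseteq> U \<and> (n, V, restrict p V) \<in> G)}"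

text \<open>Locality holds because restricting twice is restricting once. For reparametrization by
  \<open>F\<close>, a local piece on \<open>V\<close> is carried to the preimage of
  \<open>V\<close>, which is open in the new domain.\<close>

lemma locally_in_diffeology:
  assumes const: "\<And>n U x. openin (Euclidean_space n) U \<Longrightarrow> x \<in> A \<Longrightarrow> (n, U, \<lambda>u\<in>U. x) \<in> G"
    and comp: "\<And>n U p n' U' F. (n, U, p) \<in> G \<Longrightarrow> smooth_between n' U' n U F \<Longrightarrow>
      (n', U', compose U' p F) \<in> G"
  shows "diffeology A (locally_in A G)"
  unfolding diffeology_def
proof (intro conjI allI impI)
  show "locally_in A G \<subseteq> parametrizations A" by (auto simp: locally_in_def)
next
  fix n U and x assume *: "openin (Euclidean_space n) U" "x \<in> A"
  then show "(n, U, \<lambda>u\<in>U. x) \<in> locally_in A G"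
  proof -
    have "restrict (\<lambda>u\<in>U. x) U = (\<lambda>u\<in>U. x)" by simp
    then have "\<forall>u\<in>U. \<exists>V. openin (Euclidean_space n) V \<and> u \<in> V \<and> V \<subseteq> U \<and>
        (n, V, restrict (\<lambda>u\<in>U. x) V) \<in> G"
      using const[OF *] *(1) by (metis order_refl)
    then show ?thesis using * by (simp add: locally_in_def parametrizations_def)
  qed
next
  fix n U p n' U' F
  assume p: "(n, U, p) \<in> locally_in A G" and F: "smooth_between n' U' n U F"
  note U' = smooth_between_open(1)[OF F]
  have "compose U' p F \<in> U' \<rightarrow>\<^sub>E A"
    using p smooth_between_mem[OF F] by (auto simp: locally_in_def parametrizations_def compose_def)
  moreover have "\<exists>W. openin (Euclidean_space n') W \<and> u \<in> W \<and> W \<subseteq> U' \<and>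
      (n', W, restrict (compose U' p F) W) \<in> G" if u: "u \<in> U'" for u
  proof -
    obtain V where V: "openin (Euclidean_space n) V" "F u \<in> V" "V \<subseteq> U" "(n, V, restrict p V) \<in> G"
      using p smooth_between_mem[OF F u] by (auto simp: locally_in_def)
    let ?W = "{u \<in> U'. F u \<in> V}"
    have W: "openin (Euclidean_space n') ?W" by (rule smooth_between_vimage_open[OF F V(1)])
    have "(n', ?W, compose ?W (restrict p V) F) \<in> G"
      by (rule comp[OF V(4) smooth_between_restrict[OF F V(1) W]]) auto
    moreover have "compose ?W (restrict p V) F = restrict (compose U' p F) ?W"
      by (auto simp: compose_def fun_eq_iff)
    ultimately have "(n', ?W, restrict (compose U' p F) ?W) \<in> G" by simp
    then show ?thesis using u V(2) W by blast
  qed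
  ultimately show "(n', U', compose U' p F) \<in> locally_in A G"
    using U' unfolding locally_in_def parametrizations_def by blast
next
  fix n U p
  assume p: "(n, U, p) \<in> parametrizations A"
    and loc: "\<forall>u\<in>U. \<exists>V. openin (Euclidean_space n) V \<and> u \<in> V \<and> V \<subseteq> U \<and>
      (n, V, restrict p V) \<in> locally_in A G"
  have "\<exists>W. openin (Euclidean_space n) W \<and> u \<in> W \<and> W \<subseteq> U \<and> (n, W, restrict p W) \<in> G" if u: "u \<in> U" for u
  proof -
    obtain V where V: "u \<in> V" "V \<subseteq> U" "(n, V, restrict p V) \<in> locally_in A G"
      using bspec[OF loc u] by (elim exE conjE)
    then obtain W where "openin (Euclidean_space n) W" "u \<in> W" "W \<subseteq> V"
      "(n, W, restrict (restrict p V) W) \<in> G" by (auto simp: locally_in_def)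
    moreover from this have "restrict (restrict p V) W = restrict p W"
      by (simp add: Int_absorb1)
    ultimately show ?thesis using V(2) by auto
  qed
  with p show "(n, U, p) \<in> locally_in A G" unfolding locally_in_def by blast
qed

lemma locally_in_superset:
  assumes "G \<subseteq> parametrizations A"
  shows "G \<subseteq> locally_in A G"
proof
  fix P assume "P \<in> G"
  moreover obtain n U p where P: "P = (n, U, p)" by (cases P)
  ultimately have "openin (Euclidean_space n) U" "p \<in> U \<rightarrow>\<^sub>E A" "(n, U, restrict p U) \<in> G"
    using assms by (auto simp: parametrizations_def PiE_restrict)
  then show "P \<in> locally_in A G" unfolding P locally_in_def parametrizations_def by blast
qed

lemma locally_in_least:
  assumes "diffeology A D" "G \<subseteq> D"
  shows "locally_in A G \<subseteq> D"
proof
  fix P assume "P \<in> locally_in A G"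
  moreover obtain n U p where P: "P = (n, U, p)" by (cases P)
  ultimately have *: "openin (Euclidean_space n) U" "p \<in> U \<rightarrow>\<^sub>E A"
    "\<And>u. u \<in> U \<Longrightarrow> \<exists>V. openin (Euclidean_space n) V \<and> u \<in> V \<and> V \<subseteq> U \<and> (n, V, restrict p V) \<in> G"
    by (auto simp: locally_in_def parametrizations_def)
  show "P \<in> D" unfolding P
    by (rule diffeology_local[OF assms(1) *(1,2)]) (use *(3) assms(2) in blast)
qed

text \<open>Smoothness of \<open>g\<close> amounts to the inclusion of this family in the plots of
  the target, so the least diffeology making \<open>g\<close> smooth is the one generated by the
  family.\<close>

definition pushed_plots :: "'a diffeo_space \<Rightarrow> ('a \<Rightarrow> 'b) \<Rightarrow> 'b plot set"
  where "pushed_plots X g = {(n, U, compose U g p) | n U p. (n, U, p) \<in> plots X}"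

lemma smooth_iff_pushed_plots:
  "smooth X Z g \<longleftrightarrow> g \<in> points X \<rightarrow> points Z \<and> pushed_plots X g \<subseteq> plots Z"
  unfolding smooth_def pushed_plots_def by blast

lemma compose_in_PiE:
  assumes "p \<in> U \<rightarrow>\<^sub>E A" "g \<in> A \<rightarrow> B"
  shows "compose U g p \<in> U \<rightarrow>\<^sub>E B"
  using funcset_compose[of p U A g B] assms by (auto simp: PiE_def)

lemma pushed_plots_parametrizations:
  assumes "diffeological_space X" "g \<in> points X \<rightarrow> A"
  shows "pushed_plots X g \<subseteq> parametrizations A"
proof -
  note D = assms(1)[unfolded diffeological_space_def]
  have "(n, U, compose U g p) \<in> parametrizations A" if "(n, U, p) \<in> plots X" for n U p
    using diffeology_param[OF D that] assms(2) by (auto simp: parametrizations_def compose_def)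
  then show ?thesis by (auto simp: pushed_plots_def)
qed

lemma compose_compose:
  "F \<in> U' \<rightarrow> U \<Longrightarrow> compose U' (compose U g p) F = compose U' g (compose U' p F)"
  by (auto simp: compose_def fun_eq_iff)

lemma pushed_plots_compose:
  assumes "diffeological_space X" "(n, U, q) \<in> pushed_plots X g" "smooth_between n' U' n U F"
  shows "(n', U', compose U' q F) \<in> pushed_plots X g"
proof -
  obtain p where p: "(n, U, p) \<in> plots X" "q = compose U g p"
    using assms(2) by (auto simp: pushed_plots_def)
  have "compose U' q F = compose U' g (compose U' p F)"
    using assms(3) unfolding p(2) by (intro compose_compose) (simp add: smooth_between_def)
  then show ?thesis
    using diffeology_compose[OF _ p(1) assms(3)] assms(1)
    by (auto simp: pushed_plots_def diffeological_space_def)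
qed

lemma pushed_plots_const:
  assumes "diffeological_space X" "openin (Euclidean_space n) U" "x \<in> points X"
  shows "(n, U, \<lambda>u\<in>U. g x) \<in> pushed_plots X g"
proof -
  have "(\<lambda>u\<in>U. g x) = compose U g (\<lambda>u\<in>U. x)" by (auto simp: compose_def)
  then show ?thesis
    using diffeology_const[OF _ assms(2,3)] assms(1)
    by (auto simp: pushed_plots_def diffeological_space_def)
qed

text \<open>Every class has a representative, so the pushed family contains the constants; it is
  also stable under reparametrization. Localizing it once therefore gives a diffeology, and any
  diffeology making the projection smooth contains it.\<close>

lemma quotient_plots:
  assumes X: "diffeological_space X"
  shows "plots (quotient_space X r) = locally_in (points X // r) (pushed_plots X (\<lambda>x. r `` {x}))"
    (is "_ = locally_in ?A ?G")
    and quotient_diffeological: "diffeological_space (quotient_space X r)"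
    and quotient_smooth: "smooth X (quotient_space X r) (\<lambda>x. r `` {x})"
proof -
  have into: "(\<lambda>x. r `` {x}) \<in> points X \<rightarrow> ?A" by (auto intro: quotientI)
  have const: "(n, U, \<lambda>u\<in>U. y) \<in> ?G" if "openin (Euclidean_space n) U" "y \<in> ?A" for n U y
    using that(2) pushed_plots_const[OF X that(1)] by (auto elim!: quotientE)
  have D: "diffeology ?A (locally_in ?A ?G)"
    using const pushed_plots_compose[OF X] by (rule locally_in_diffeology)
  have G: "?G \<subseteq> locally_in ?A ?G"
    by (rule locally_in_superset[OF pushed_plots_parametrizations[OF X into]])
  have "(LEAST D. diffeology ?A D \<and> smooth X \<lparr>points = ?A, plots = D\<rparr> (\<lambda>x. r `` {x})) = locally_in ?A ?G"
  proof (rule Least_equality)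
    show "locally_in ?A ?G \<subseteq> D'"
      if "diffeology ?A D' \<and> smooth X \<lparr>points = ?A, plots = D'\<rparr> (\<lambda>x. r `` {x})" for D'
      using that by (intro locally_in_least) (auto simp: smooth_iff_pushed_plots)
  qed (use D G into in \<open>auto simp: smooth_iff_pushed_plots\<close>)
  then show eq: "plots (quotient_space X r) = locally_in ?A ?G"
    by (simp add: quotient_space_def)
  show "diffeological_space (quotient_space X r)"
    using D unfolding diffeological_space_def eq by (simp add: quotient_space_def)
  show "smooth X (quotient_space X r) (\<lambda>x. r `` {x})"
    using G into unfolding smooth_iff_pushed_plots eq by (simp add: quotient_space_def)
qed

text \<open>Each point of the sum comes from one of the summands, so the two pushed families
  together contain the constants. The description says that a plot of the sum stays in a single
  summand near each point, which is the form used in \<open>lift_exists\<close>.\<close>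

lemma sum_plots:
  assumes X: "diffeological_space X" and Z: "diffeological_space Z"
  shows "plots (sum_space X Z) =
      locally_in (points X <+> points Z) (pushed_plots X Inl \<union> pushed_plots Z Inr)"
    (is "_ = locally_in ?A ?G")
    and sum_diffeological: "diffeological_space (sum_space X Z)"
    and sum_smooth_Inl: "smooth X (sum_space X Z) Inl"
    and sum_smooth_Inr: "smooth Z (sum_space X Z) Inr"
proof -
  have into: "Inl \<in> points X \<rightarrow> ?A" "Inr \<in> points Z \<rightarrow> ?A" by auto
  have const: "(n, U, \<lambda>u\<in>U. y) \<in> ?G" if "openin (Euclidean_space n) U" "y \<in> ?A" for n U y
    using that(2) pushed_plots_const[OF X that(1)] pushed_plots_const[OF Z that(1)]
    by (auto elim!: PlusE)
  have D: "diffeology ?A (locally_in ?A ?G)"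
  proof (rule locally_in_diffeology[OF const])
    show "(n', U', compose U' p F) \<in> ?G"
      if "(n, U, p) \<in> ?G" "smooth_between n' U' n U F" for n U p n' U' F
      using that(1) pushed_plots_compose[OF X _ that(2), of p]
        pushed_plots_compose[OF Z _ that(2), of p] by auto
  qed
  have G: "?G \<subseteq> locally_in ?A ?G"
    using pushed_plots_parametrizations[OF X into(1)] pushed_plots_parametrizations[OF Z into(2)]
    by (intro locally_in_superset) blast
  have "(LEAST D. diffeology ?A D \<and> smooth X \<lparr>points = ?A, plots = D\<rparr> Inl \<and>
      smooth Z \<lparr>points = ?A, plots = D\<rparr> Inr) = locally_in ?A ?G"
  proof (rule Least_equality)
    show "locally_in ?A ?G \<subseteq> D'"
      if "diffeology ?A D' \<and> smooth X \<lparr>points = ?A, plots = D'\<rparr> Inl \<and>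
        smooth Z \<lparr>points = ?A, plots = D'\<rparr> Inr" for D'
      using that by (intro locally_in_least) (auto simp: smooth_iff_pushed_plots)
  qed (use D G into in \<open>auto simp: smooth_iff_pushed_plots\<close>)
  then show eq: "plots (sum_space X Z) = locally_in ?A ?G"
    by (simp add: sum_space_def)
  show "diffeological_space (sum_space X Z)"
    using D unfolding diffeological_space_def eq by (simp add: sum_space_def)
  show "smooth X (sum_space X Z) Inl" "smooth Z (sum_space X Z) Inr"
    using G into unfolding smooth_iff_pushed_plots eq by (auto simp: sum_space_def)
qed

lemma smooth_comp:
  assumes X: "diffeological_space X" and g: "smooth X Z g" and h: "smooth Z W h"
  shows "smooth X W (\<lambda>x. h (g x))"
  unfolding smooth_def
proof (intro conjI allI impI)
  show "(\<lambda>x. h (g x)) \<in> points X \<rightarrow> points W" using g h by (auto simp: smooth_def)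
  fix n U p assume "(n, U, p) \<in> plots X"
  then have "(n, U, compose U h (compose U g p)) \<in> plots W" using g h by (simp add: smooth_def)
  moreover have "compose U h (compose U g p) = compose U (\<lambda>x. h (g x)) p"
    by (auto simp: compose_def fun_eq_iff)
  ultimately show "(n, U, compose U (\<lambda>x. h (g x)) p) \<in> plots W" by simp
qed

text \<open>The maps whose two components are plots satisfy the axioms componentwise. Smoothness of
  the projections puts every competing diffeology inside this set, which identifies the
  \<open>GREATEST\<close>.\<close>

lemma prod_plots:
  assumes X: "diffeological_space X" and Z: "diffeological_space Z"
  shows "plots (prod_space X Z) = {(n, U, p). (n, U, p) \<in> parametrizations (points X \<times> points Z) \<and>
    (n, U, compose U fst p) \<in> plots X \<and> (n, U, compose U snd p) \<in> plots Z}" (is "_ = ?D")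
proof -
  let ?A = "points X \<times> points Z"
  note DX = X[unfolded diffeological_space_def] and DZ = Z[unfolded diffeological_space_def]
  have D: "diffeology ?A ?D"
    unfolding diffeology_def
  proof (intro conjI allI impI)
    show "?D \<subseteq> parametrizations ?A" by blast
  next
    fix n U x assume *: "openin (Euclidean_space n) U" "x \<in> ?A"
    have "compose U fst (\<lambda>u\<in>U. x) = (\<lambda>u\<in>U. fst x)" "compose U snd (\<lambda>u\<in>U. x) = (\<lambda>u\<in>U. snd x)"
      by (auto simp: compose_def fun_eq_iff)
    then show "(n, U, \<lambda>u\<in>U. x) \<in> ?D"
      using * diffeology_const[OF DX *(1), of "fst x"] diffeology_const[OF DZ *(1), of "snd x"]
      by (auto simp: parametrizations_def)
  next
    fix n U p n' U' F assume p: "(n, U, p) \<in> ?D" and F: "smooth_between n' U' n U F"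
    have F': "F \<in> U' \<rightarrow> U" using F by (simp add: smooth_between_def)
    have "(n', U', compose U' p F) \<in> parametrizations ?A"
    proof -
      have "p \<in> U \<rightarrow> ?A" "compose U' p F \<in> extensional U'"
        using p by (auto simp: parametrizations_def)
      then show ?thesis
        using funcset_compose[OF F'] smooth_between_open(1)[OF F]
        by (auto simp: parametrizations_def PiE_def)
    qed
    then show "(n', U', compose U' p F) \<in> ?D"
      using p diffeology_compose[OF DX _ F, of "compose U fst p"]
        diffeology_compose[OF DZ _ F, of "compose U snd p"]
      by (simp add: compose_compose[OF F'])
  next
    fix n U p
    assume p: "(n, U, p) \<in> parametrizations ?A"
      and loc: "\<forall>u\<in>U. \<exists>V. openin (Euclidean_space n) V \<and> u \<in> V \<and> V \<subseteq> U \<and> (n, V, restrict p V) \<in> ?D"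
    have U: "openin (Euclidean_space n) U" "p \<in> U \<rightarrow>\<^sub>E ?A" using p by (auto simp: parametrizations_def)
    have "(n, U, compose U fst p) \<in> plots X"
    proof (rule diffeology_local[OF DX U(1)])
      show "compose U fst p \<in> U \<rightarrow>\<^sub>E points X" by (rule compose_in_PiE[OF U(2)]) auto
      fix u assume "u \<in> U"
      then obtain V where "openin (Euclidean_space n) V" "u \<in> V" "V \<subseteq> U" "(n, V, restrict p V) \<in> ?D"
        using loc by blast
      moreover have "compose V fst (restrict p V) = restrict (compose U fst p) V"
        using \<open>V \<subseteq> U\<close> by (auto simp: compose_def fun_eq_iff)
      ultimately show "\<exists>V. openin (Euclidean_space n) V \<and> u \<in> V \<and> V \<subseteq> U \<and>
          (n, V, restrict (compose U fst p) V) \<in> plots X" by auto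
    qed
    moreover have "(n, U, compose U snd p) \<in> plots Z"
    proof (rule diffeology_local[OF DZ U(1)])
      show "compose U snd p \<in> U \<rightarrow>\<^sub>E points Z" by (rule compose_in_PiE[OF U(2)]) auto
      fix u assume "u \<in> U"
      then obtain V where "openin (Euclidean_space n) V" "u \<in> V" "V \<subseteq> U" "(n, V, restrict p V) \<in> ?D"
        using loc by blast
      moreover have "compose V snd (restrict p V) = restrict (compose U snd p) V"
        using \<open>V \<subseteq> U\<close> by (auto simp: compose_def fun_eq_iff)
      ultimately show "\<exists>V. openin (Euclidean_space n) V \<and> u \<in> V \<and> V \<subseteq> U \<and>
          (n, V, restrict (compose U snd p) V) \<in> plots Z" by auto
    qed
    ultimately show "(n, U, p) \<in> ?D" using p by blast
  qed
  have "(GREATEST D. diffeology ?A D \<and> smooth \<lparr>points = ?A, plots = D\<rparr> X fst \<and>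
      smooth \<lparr>points = ?A, plots = D\<rparr> Z snd) = ?D"
  proof (rule Greatest_equality)
    show "D' \<subseteq> ?D"
      if "diffeology ?A D' \<and> smooth \<lparr>points = ?A, plots = D'\<rparr> X fst \<and>
        smooth \<lparr>points = ?A, plots = D'\<rparr> Z snd" for D'
      using that by (auto simp: smooth_def diffeology_def)
  qed (use D in \<open>auto simp: smooth_def\<close>)
  then show ?thesis by (simp add: prod_space_def)
qed

subsection \<open>Restriction and pullback of forms\<close>

lemma formsD:
  assumes "\<omega> \<in> forms m X"
  shows forms_outside: "P \<notin> plots X \<Longrightarrow> \<omega> P = (\<lambda>u vs. 0)"
    and forms_domain: "(n, U, p) \<in> plots X \<Longrightarrow> \<omega> (n, U, p) \<in> domain_forms m n U"
    and forms_compose: "(n, U, p) \<in> plots X \<Longrightarrow> smooth_between n' U' n U F \<Longrightarrow>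
      \<omega> (n', U', compose U' p F) = domain_pullback m n' U' F (\<omega> (n, U, p))"
  using assms unfolding forms_def by blast+

lemma forms_smooth:
  assumes "\<omega> \<in> forms m X" "(n, U, p) \<in> plots X"
  shows "smooth_to_covectors m n n U (\<omega> (n, U, p))"
  using forms_domain[OF assms] by (simp add: domain_forms_def)

lemma forms_not_in_domain:
  assumes "\<omega> \<in> forms m X" "u \<notin> U"
  shows "\<omega> (n, U, p) u = (\<lambda>vs. 0)"
proof (cases "(n, U, p) \<in> plots X")
  case True
  then show ?thesis using forms_domain[OF assms(1) True] assms(2) by (simp add: domain_forms_def)
qed (simp add: forms_outside[OF assms(1)])

lemma forms_covector:
  assumes "\<omega> \<in> forms m X" "(n, U, p) \<in> plots X" "u \<in> U"
  shows "\<omega> (n, U, p) u \<in> covectors m n"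
  using forms_smooth[OF assms(1,2)] assms(3) by (simp add: smooth_to_covectors_def)

lemma domain_pullback_inclusion:
  assumes "\<eta> u \<in> covectors m n" "u \<in> V"
  shows "domain_pullback m n V (\<lambda>x. x) \<eta> u = \<eta> u"
proof
  fix vs
  show "domain_pullback m n V (\<lambda>x. x) \<eta> u vs = \<eta> u vs"
  proof (cases "vs \<in> vector_tuples m n")
    case True
    then have "map (differential n (\<lambda>x. x) u) vs = vs"
      by (intro map_idI differential_ident) (auto simp: vector_tuples_def)
    with True assms(2) show ?thesis by (simp add: domain_pullback_def)
  next
    case False
    then show ?thesis using assms(1) by (simp add: domain_pullback_def covectors_def)
  qed
qed

text \<open>Restriction is reparametrization along an inclusion, and the differential of an
  inclusion is the identity on \<open>Rn n\<close>. Values of forms are therefore local: lifts on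
  different domains can be compared at a point after shrinking to a common one.\<close>

lemma forms_restrict:
  assumes X: "diffeological_space X" and w: "\<omega> \<in> forms m X" and p: "(n, U, p) \<in> plots X"
    and V: "openin (Euclidean_space n) V" "V \<subseteq> U" "u \<in> V"
  shows "\<omega> (n, V, restrict p V) u = \<omega> (n, U, p) u"
proof -
  have U: "openin (Euclidean_space n) U"
    using diffeology_param(1) X p unfolding diffeological_space_def by blast
  have "\<omega> (n, V, restrict p V) = domain_pullback m n V (\<lambda>x. x) (\<omega> (n, U, p))"
    using forms_compose[OF w p smooth_between_inclusion[OF U V(1,2)]] by (simp add: compose_ident)
  then show ?thesis
    using domain_pullback_inclusion forms_covector[OF w p] V(2,3) by auto
qed

lemma pullback_apply:
  "(n, U, p) \<in> plots A \<Longrightarrow> pullback A g \<omega> (n, U, p) = \<omega> (n, U, compose U g p)"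
  by (simp add: pullback_def)

lemma pullback_forms:
  assumes A: "diffeological_space A" and g: "smooth A B g" and w: "\<omega> \<in> forms m B"
  shows "pullback A g \<omega> \<in> forms m A"
  unfolding forms_def
proof (intro CollectI conjI allI impI)
  fix P assume "P \<notin> plots A"
  then show "pullback A g \<omega> P = (\<lambda>u vs. 0)" by (cases P) (simp add: pullback_def)
next
  fix n U p assume p: "(n, U, p) \<in> plots A"
  then have gp: "(n, U, compose U g p) \<in> plots B" using g by (simp add: smooth_def)
  then show "pullback A g \<omega> (n, U, p) \<in> domain_forms m n U"
    using p forms_domain[OF w] by (simp add: pullback_apply)
  fix n' U' F assume F: "smooth_between n' U' n U F"
  have "(n', U', compose U' p F) \<in> plots A"
    using diffeology_compose A p F unfolding diffeological_space_def by blast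
  then show "pullback A g \<omega> (n', U', compose U' p F) =
      domain_pullback m n' U' F (pullback A g \<omega> (n, U, p))"
    using forms_compose[OF w gp F] p compose_compose[of F U' U g p] F
    by (simp add: pullback_apply smooth_between_def)
qed

subsection \<open>The functional diffeology\<close>

lemma first_part_in_Rn: "first_part k w \<in> Rn k"
  by (simp add: Rn_iff first_part_def)

lemma second_part_in_Rn: "w \<in> Rn (k + n) \<Longrightarrow> second_part k w \<in> Rn n"
  by (simp add: Rn_iff second_part_def)

lemma domain_product_open:
  assumes "openin (Euclidean_space k) U'" "openin (Euclidean_space n) U"
  shows "openin (Euclidean_space (k + n)) (domain_product k U' n U)"
proof -
  obtain S T where S: "open S" "U' = Rn k \<inter> S" and T: "open T" "U = Rn n \<inter> T"
    using assms by (auto simp: domain_iff_open)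
  have c1: "continuous_on UNIV (first_part k)"
  proof (rule continuous_on_coordinatewise_then_product)
    show "continuous_on UNIV (\<lambda>w. first_part k w i)" for i
      by (cases "i < k")
         (simp_all add: first_part_def continuous_on_product_then_coordinatewise[OF continuous_on_id])
  qed
  have c2: "continuous_on UNIV (second_part k)"
    by (rule continuous_on_coordinatewise_then_product)
       (simp add: second_part_def continuous_on_product_then_coordinatewise[OF continuous_on_id])
  have "domain_product k U' n U = Rn (k + n) \<inter> (first_part k -` S \<inter> second_part k -` T)"
    using first_part_in_Rn second_part_in_Rn by (auto simp: domain_product_def S(2) T(2))
  moreover have "open (first_part k -` S \<inter> second_part k -` T)"
    using open_vimage[OF S(1) c1] open_vimage[OF T(1) c2] by (rule open_Int)
  ultimately show ?thesis unfolding domain_iff_open by blast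
qed

lemma smooth_first_part:
  assumes "openin (Euclidean_space k) U'" "openin (Euclidean_space n) U"
  shows "smooth_between (k + n) (domain_product k U' n U) k U' (first_part k)"
  unfolding smooth_between_def
proof (intro conjI allI impI domain_product_open assms)
  show "first_part k \<in> domain_product k U' n U \<rightarrow> U'" by (simp add: domain_product_def)
  show "C_infinity (k + n) (domain_product k U' n U) (\<lambda>w. first_part k w i)" if "i < k" for i
    using C_infinity_coordinate[OF domain_product_open[OF assms]] that by (simp add: first_part_def)
qed

lemma smooth_second_part:
  assumes "openin (Euclidean_space k) U'" "openin (Euclidean_space n) U"
  shows "smooth_between (k + n) (domain_product k U' n U) n U (second_part k)"
  unfolding smooth_between_def
proof (intro conjI allI impI domain_product_open assms)
  show "second_part k \<in> domain_product k U' n U \<rightarrow> U" by (simp add: domain_product_def)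
  show "C_infinity (k + n) (domain_product k U' n U) (\<lambda>w. second_part k w i)" for i
    using C_infinity_coordinate[OF domain_product_open[OF assms]] by (simp add: second_part_def)
qed

text \<open>\<open>H\<close> is F x id in concatenated coordinates. An index \<open>i\<close> beyond
  the block of length \<open>k\<close> is read at \<open>k' + (i - k)\<close>, because the parameter
  block of the source has length \<open>k'\<close>.\<close>

lemma smooth_product_first:
  assumes F: "smooth_between k' U'' k U' F" and U: "openin (Euclidean_space n) U"
  defines "H \<equiv> \<lambda>w i. if i < k then F (first_part k' w) i else w (k' + (i - k))"
  shows "smooth_between (k' + n) (domain_product k' U'' n U) (k + n) (domain_product k U' n U) H"
    and "w \<in> domain_product k' U'' n U \<Longrightarrow> first_part k (H w) = F (first_part k' w)"
    and "second_part k (H w) = second_part k' w"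
proof -
  note O = smooth_between_open[OF F]
  show snd: "second_part k (H w) = second_part k' w" for w
    by (simp add: H_def second_part_def)
  show fst: "first_part k (H w) = F (first_part k' w)" if "w \<in> domain_product k' U'' n U" for w
  proof -
    have "F (first_part k' w) \<in> U'"
      using that smooth_between_mem[OF F] by (simp add: domain_product_def)
    then show ?thesis
      using domain_zero[OF O(2)] by (auto simp: H_def first_part_def fun_eq_iff)
  qed
  show "smooth_between (k' + n) (domain_product k' U'' n U) (k + n) (domain_product k U' n U) H"
    unfolding smooth_between_def
  proof (intro conjI allI impI domain_product_open O U)
    show "H \<in> domain_product k' U'' n U \<rightarrow> domain_product k U' n U"
    proof
      fix w assume w: "w \<in> domain_product k' U'' n U"
      then have "F (first_part k' w) \<in> U'" "second_part k' w \<in> U"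
        using smooth_between_mem[OF F] by (simp_all add: domain_product_def)
      moreover have "H w \<in> Rn (k + n)"
        using w by (auto simp: H_def Rn_iff domain_product_def)
      ultimately show "H w \<in> domain_product k U' n U"
        using fst[OF w] snd by (simp add: domain_product_def)
    qed
    fix i assume "i < k + n"
    show "C_infinity (k' + n) (domain_product k' U'' n U) (\<lambda>w. H w i)"
    proof (cases "i < k")
      case True
      have "C_infinity k' U'' (\<lambda>u. F u i)" using F True by (simp add: smooth_between_def)
      from C_infinity_compose[OF smooth_first_part[OF O(1) U] this] True
      show ?thesis by (simp add: H_def)
    next
      case False
      then show ?thesis
        using C_infinity_coordinate[OF domain_product_open[OF O(1) U]] by (simp add: H_def)
    qed
  qed
qed

lemma points_Omega [simp]: "points (Omega m X) = forms m X"
  by (simp add: Omega_def)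

lemma plots_Omega_iff:
  "(k, U', Q) \<in> plots (Omega m X) \<longleftrightarrow> openin (Euclidean_space k) U' \<and> Q \<in> U' \<rightarrow>\<^sub>E forms m X \<and>
    (\<forall>n U p. (n, U, p) \<in> plots X \<longrightarrow> smooth_to_covectors m n (k + n) (domain_product k U' n U)
      (\<lambda>w. Q (first_part k w) (n, U, p) (second_part k w)))"
  by (simp add: Omega_def parametrizations_def)

text \<open>Each axiom is a statement about test maps on a product U' x U. For a constant plot the
  test map factors through the second projection; reparametrizing the parameter by \<open>F\<close>
  composes it with F x id; and a cover of U' by open sets V gives a cover of U' x U by the open sets
  V x U.\<close>

lemma Omega_diffeological:
  assumes X: "diffeological_space X"
  shows "diffeological_space (Omega m X)"
  unfolding diffeological_space_def diffeology_def points_Omega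
proof (intro conjI allI impI)
  note DX = X[unfolded diffeological_space_def]
  show "plots (Omega m X) \<subseteq> parametrizations (forms m X)"
    by (auto simp: plots_Omega_iff parametrizations_def)
  {
    fix k U' \<omega> assume U': "openin (Euclidean_space k) U'" and w: "\<omega> \<in> forms m X"
    have "smooth_to_covectors m n (k + n) (domain_product k U' n U)
      (\<lambda>w. (\<lambda>u\<in>U'. \<omega>) (first_part k w) (n, U, p) (second_part k w))" if p: "(n, U, p) \<in> plots X" for n U p
    proof -
      have U: "openin (Euclidean_space n) U" by (rule diffeology_param(1)[OF DX p])
      show ?thesis
        by (rule smooth_to_covectors_cong[OF domain_product_open[OF U' U]
              smooth_to_covectors_compose[OF smooth_second_part[OF U' U] forms_smooth[OF w p]]])
           (simp add: domain_product_def)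
    qed
    then show "(k, U', \<lambda>u\<in>U'. \<omega>) \<in> plots (Omega m X)"
      using U' w by (simp add: plots_Omega_iff)
  next
    fix k U' Q k' U'' F
    assume Q: "(k, U', Q) \<in> plots (Omega m X)" and F: "smooth_between k' U'' k U' F"
    have "smooth_to_covectors m n (k' + n) (domain_product k' U'' n U)
      (\<lambda>w. compose U'' Q F (first_part k' w) (n, U, p) (second_part k' w))"
      if p: "(n, U, p) \<in> plots X" for n U p
    proof -
      have U: "openin (Euclidean_space n) U" by (rule diffeology_param(1)[OF DX p])
      have "smooth_to_covectors m n (k + n) (domain_product k U' n U)
        (\<lambda>w. Q (first_part k w) (n, U, p) (second_part k w))"
        using Q p by (simp add: plots_Omega_iff)
      note S = smooth_to_covectors_compose[OF smooth_product_first(1)[OF F U] this]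
      show ?thesis
        by (rule smooth_to_covectors_cong[OF domain_product_open[OF smooth_between_open(1)[OF F] U] S])
           (simp add: smooth_product_first(2,3)[OF F U], simp add: domain_product_def compose_def)
    qed
    moreover have "compose U'' Q F \<in> U'' \<rightarrow>\<^sub>E forms m X"
      using Q smooth_between_mem[OF F] by (auto simp: plots_Omega_iff compose_def)
    ultimately show "(k', U'', compose U'' Q F) \<in> plots (Omega m X)"
      using smooth_between_open(1)[OF F] by (simp add: plots_Omega_iff)
  next
    fix k U' Q
    assume Q: "(k, U', Q) \<in> parametrizations (forms m X)"
      and loc: "\<forall>u\<in>U'. \<exists>V. openin (Euclidean_space k) V \<and> u \<in> V \<and> V \<subseteq> U' \<and>
        (k, V, restrict Q V) \<in> plots (Omega m X)"
    have U': "openin (Euclidean_space k) U'" using Q by (simp add: parametrizations_def)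
    have "smooth_to_covectors m n (k + n) (domain_product k U' n U)
      (\<lambda>w. Q (first_part k w) (n, U, p) (second_part k w))" if p: "(n, U, p) \<in> plots X" for n U p
    proof -
      have U: "openin (Euclidean_space n) U" by (rule diffeology_param(1)[OF DX p])
      show ?thesis
      proof (rule smooth_to_covectors_local[OF domain_product_open[OF U' U]])
        fix w assume w: "w \<in> domain_product k U' n U"
        then obtain V where V: "openin (Euclidean_space k) V" "first_part k w \<in> V" "V \<subseteq> U'"
          "(k, V, restrict Q V) \<in> plots (Omega m X)"
          using loc by (auto simp: domain_product_def)
        have "smooth_to_covectors m n (k + n) (domain_product k V n U)
          (\<lambda>w. restrict Q V (first_part k w) (n, U, p) (second_part k w))"
          using V(4) p by (simp add: plots_Omega_iff)
        then have "smooth_to_covectors m n (k + n) (domain_product k V n U)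
          (\<lambda>w. Q (first_part k w) (n, U, p) (second_part k w))"
          by (rule smooth_to_covectors_cong[OF domain_product_open[OF V(1) U]])
             (simp add: domain_product_def)
        moreover have "w \<in> domain_product k V n U" using w V(2) by (simp add: domain_product_def)
        ultimately show "\<exists>W. openin (Euclidean_space (k + n)) W \<and> w \<in> W \<and>
            smooth_to_covectors m n (k + n) W (\<lambda>w. Q (first_part k w) (n, U, p) (second_part k w))"
          using domain_product_open[OF V(1) U] by blast
      qed
    qed
    then show "(k, U', Q) \<in> plots (Omega m X)"
      using Q by (simp add: plots_Omega_iff parametrizations_def)
  }
qed

text \<open>Testing the family of pullbacks on a plot \<open>p\<close> of \<open>A\<close> is
  testing \<open>Q\<close> on the plot \<open>compose U g p\<close> of \<open>B\<close>.\<close>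

lemma pullback_plot_Omega:
  assumes A: "diffeological_space A" and g: "smooth A B g"
    and Q: "(k, U', Q) \<in> plots (Omega m B)"
  shows "(k, U', \<lambda>u\<in>U'. pullback A g (Q u)) \<in> plots (Omega m A)"
  unfolding plots_Omega_iff
proof (intro conjI allI impI)
  show U': "openin (Euclidean_space k) U'" using Q by (simp add: plots_Omega_iff)
  show "(\<lambda>u\<in>U'. pullback A g (Q u)) \<in> U' \<rightarrow>\<^sub>E forms m A"
    using Q pullback_forms[OF A g] by (auto simp: plots_Omega_iff)
  fix n U p assume p: "(n, U, p) \<in> plots A"
  have U: "openin (Euclidean_space n) U"
    using diffeology_param(1) A p unfolding diffeological_space_def by blast
  have "(n, U, compose U g p) \<in> plots B" using g p by (simp add: smooth_def)
  then have "smooth_to_covectors m n (k + n) (domain_product k U' n U)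
      (\<lambda>w. Q (first_part k w) (n, U, compose U g p) (second_part k w))"
    using Q by (simp add: plots_Omega_iff)
  then show "smooth_to_covectors m n (k + n) (domain_product k U' n U)
      (\<lambda>w. (\<lambda>u\<in>U'. pullback A g (Q u)) (first_part k w) (n, U, p) (second_part k w))"
    by (rule smooth_to_covectors_cong[OF domain_product_open[OF U' U]])
       (use p in \<open>simp add: domain_product_def pullback_apply\<close>)
qed

subsection \<open>Forms on a gluing\<close>

text \<open>A normal form for the generated equivalence: points of \<open>Y\<close> move to their
  image in the second summand, where nothing moves any further.\<close>

definition glue_rep :: "'a set \<Rightarrow> ('a \<Rightarrow> 'b) \<Rightarrow> 'a + 'b \<Rightarrow> 'a + 'b"
  where "glue_rep Y f s = (case s of Inl x \<Rightarrow> if x \<in> Y then Inr (f x) else Inl x | Inr z \<Rightarrow> Inr z)"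

text \<open>The normal form is unchanged along a generating pair, hence along any chain of such
  pairs. Conversely each point reaches its normal form in at most one generating step, so points
  with a common normal form are joined through it.\<close>

lemma equivclp_glue_iff:
  "equivclp (\<lambda>s t. \<exists>y\<in>Y. s = Inl y \<and> t = Inr (f y)) a b \<longleftrightarrow> glue_rep Y f a = glue_rep Y f b"
    (is "equivclp ?R a b \<longleftrightarrow> _")
proof
  assume "equivclp ?R a b"
  then show "glue_rep Y f a = glue_rep Y f b"
    by (induction rule: equivclp_induct) (auto simp: glue_rep_def)
next
  have rep: "equivclp ?R s (glue_rep Y f s)" for s
  proof (cases "\<exists>y\<in>Y. s = Inl y")
    case True
    then show ?thesis by (intro r_into_equivclp) (auto simp: glue_rep_def)
  next
    case False
    then have "glue_rep Y f s = s" by (auto simp: glue_rep_def split: sum.split)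
    then show ?thesis by simp
  qed
  assume eq: "glue_rep Y f a = glue_rep Y f b"
  have "equivclp ?R a (glue_rep Y f b)" using rep[of a] unfolding eq .
  then show "equivclp ?R a b" by (rule equivclp_trans) (rule equivclp_sym[OF rep])
qed

section \<open>The gluing and the lifts of its plots\<close>

locale gluing_data =
  fixes X1 :: "'a diffeo_space" and X2 :: "'b diffeo_space"
    and Y :: "'a set" and f :: "'a \<Rightarrow> 'b"
  assumes X1: "diffeological_space X1"
    and X2: "diffeological_space X2"
    and Y: "Y \<subseteq> points X1"
    and f: "smooth (subset_space X1 Y) X2 f"
begin

abbreviation G :: "('a + 'b) set diffeo_space"
  where "G \<equiv> gluing X1 X2 Y f"

definition proj1 :: "'a \<Rightarrow> ('a + 'b) set"
  where "proj1 x = gluing_relation X1 X2 Y f `` {Inl x}"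

definition proj2 :: "'b \<Rightarrow> ('a + 'b) set"
  where "proj2 z = gluing_relation X1 X2 Y f `` {Inr z}"

lemma f_into: "y \<in> Y \<Longrightarrow> f y \<in> points X2"
  using f by (auto simp: smooth_def subset_space_def)

lemma class_eq_iff:
  assumes "a \<in> points X1 <+> points X2" "b \<in> points X1 <+> points X2"
  shows "gluing_relation X1 X2 Y f `` {a} = gluing_relation X1 X2 Y f `` {b} \<longleftrightarrow>
    glue_rep Y f a = glue_rep Y f b"
proof -
  have cl: "gluing_relation X1 X2 Y f `` {s} =
      {t \<in> points X1 <+> points X2. glue_rep Y f s = glue_rep Y f t}"
    if "s \<in> points X1 <+> points X2" for s
    using that by (auto simp: gluing_relation_def equivclp_glue_iff sum_space_def)
  show ?thesis
  proof
    assume "gluing_relation X1 X2 Y f `` {a} = gluing_relation X1 X2 Y f `` {b}"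
    moreover have "b \<in> gluing_relation X1 X2 Y f `` {b}" unfolding cl[OF assms(2)] using assms(2) by simp
    ultimately have "b \<in> gluing_relation X1 X2 Y f `` {a}" by simp
    then show "glue_rep Y f a = glue_rep Y f b" unfolding cl[OF assms(1)] by simp
  qed (simp only: cl[OF assms(1)] cl[OF assms(2)])
qed

text \<open>Distinct points of \<open>X1\<close> are identified only through a common image in
  \<open>X2\<close>. The right-hand side is what \<open>f_equivalent\<close> asks at each point, so
  plots of \<open>X1\<close> on one domain are \<open>f\<close>-equivalent exactly when they become
  the same plot of the gluing.\<close>

lemma proj1_eq_iff:
  assumes "x \<in> points X1" "x' \<in> points X1"
  shows "proj1 x = proj1 x' \<longleftrightarrow> x = x' \<or> x \<in> Y \<and> x' \<in> Y \<and> f x = f x'"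
  unfolding proj1_def using assms by (subst class_eq_iff) (auto simp: glue_rep_def)

lemma proj2_eq_iff:
  assumes "z \<in> points X2" "z' \<in> points X2"
  shows "proj2 z = proj2 z' \<longleftrightarrow> z = z'"
  unfolding proj2_def using assms by (subst class_eq_iff) (auto simp: glue_rep_def)

lemma proj1_eq_proj2_iff:
  assumes "x \<in> points X1" "z \<in> points X2"
  shows "proj1 x = proj2 z \<longleftrightarrow> x \<in> Y \<and> f x = z"
  unfolding proj1_def proj2_def using assms by (subst class_eq_iff) (auto simp: glue_rep_def)

lemma gluing_diffeological: "diffeological_space G"
  unfolding gluing_def by (rule quotient_diffeological[OF sum_diffeological[OF X1 X2]])

lemma smooth_proj1: "smooth X1 G proj1"
  unfolding gluing_def proj1_def[abs_def]
  by (rule smooth_comp[OF X1 sum_smooth_Inl[OF X1 X2] quotient_smooth[OF sum_diffeological[OF X1 X2]]])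

lemma smooth_proj2: "smooth X2 G proj2"
  unfolding gluing_def proj2_def[abs_def]
  by (rule smooth_comp[OF X2 sum_smooth_Inr[OF X1 X2] quotient_smooth[OF sum_diffeological[OF X1 X2]]])

text \<open>The domain of \<open>p\<close> is not recorded and only its values on \<open>V\<close>
  matter, so lifts over different sets \<open>V\<close> can be compared on intersections. That
  \<open>V\<close> is open is part of \<open>q\<close> being a plot.\<close>

definition lift1 :: "nat \<Rightarrow> (nat \<Rightarrow> real) set \<Rightarrow> ((nat \<Rightarrow> real) \<Rightarrow> 'a) \<Rightarrow> ((nat \<Rightarrow> real) \<Rightarrow> ('a + 'b) set) \<Rightarrow> bool"
  where "lift1 n V q p \<longleftrightarrow> (n, V, q) \<in> plots X1 \<and> (\<forall>v\<in>V. p v = proj1 (q v))"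

definition lift2 :: "nat \<Rightarrow> (nat \<Rightarrow> real) set \<Rightarrow> ((nat \<Rightarrow> real) \<Rightarrow> 'b) \<Rightarrow> ((nat \<Rightarrow> real) \<Rightarrow> ('a + 'b) set) \<Rightarrow> bool"
  where "lift2 n V q p \<longleftrightarrow> (n, V, q) \<in> plots X2 \<and> (\<forall>v\<in>V. p v = proj2 (q v))"

lemma X1_plot:
  assumes "(n, U, p) \<in> plots X1"
  shows "openin (Euclidean_space n) U" "u \<in> U \<Longrightarrow> p u \<in> points X1" "p \<in> extensional U"
  using diffeology_param[OF X1[unfolded diffeological_space_def] assms] by (auto simp: PiE_def)

lemma X2_plot:
  assumes "(n, U, p) \<in> plots X2"
  shows "openin (Euclidean_space n) U" "u \<in> U \<Longrightarrow> p u \<in> points X2" "p \<in> extensional U"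
  using diffeology_param[OF X2[unfolded diffeological_space_def] assms] by (auto simp: PiE_def)

lemma G_plot_open: "(n, U, p) \<in> plots G \<Longrightarrow> openin (Euclidean_space n) U"
  using diffeology_param(1) gluing_diffeological unfolding diffeological_space_def by blast

text \<open>Two localizations in a row: a plot of the quotient comes near \<open>u\<close> from a
  plot of the disjoint sum, and after shrinking once more that plot has values in a single
  summand.\<close>

lemma lift_exists:
  assumes p: "(n, U, p) \<in> plots G" and u: "u \<in> U"
  obtains (1) V q where "V \<subseteq> U" "u \<in> V" "lift1 n V q p"
  | (2) V q where "V \<subseteq> U" "u \<in> V" "lift2 n V q p"
proof -
  let ?r = "gluing_relation X1 X2 Y f" and ?S = "sum_space X1 X2"
  obtain V where V: "u \<in> V" "V \<subseteq> U" "(n, V, restrict p V) \<in> pushed_plots ?S (\<lambda>s. ?r `` {s})"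
    using p u unfolding gluing_def quotient_plots[OF sum_diffeological[OF X1 X2]]
    by (auto simp: locally_in_def)
  then obtain s where s: "(n, V, s) \<in> plots ?S" "restrict p V = compose V (\<lambda>s. ?r `` {s}) s"
    by (auto simp: pushed_plots_def)
  then obtain W where W: "u \<in> W" "W \<subseteq> V"
    "(n, W, restrict s W) \<in> pushed_plots X1 Inl \<union> pushed_plots X2 Inr"
    using V(1) unfolding sum_plots[OF X1 X2] by (auto simp: locally_in_def)
  have ps: "p v = ?r `` {s v}" if "v \<in> W" for v
    using fun_cong[OF s(2), of v] that W(2) by (auto simp: compose_def)
  from W(3) consider q where "(n, W, q) \<in> plots X1" "restrict s W = compose W Inl q"
    | q where "(n, W, q) \<in> plots X2" "restrict s W = compose W Inr q"
    by (auto simp: pushed_plots_def)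
  then show thesis
  proof cases
    case (1 q)
    have "s v = Inl (q v)" if "v \<in> W" for v
      using fun_cong[OF 1(2), of v] that by (auto simp: compose_def)
    then have "lift1 n W q p" using 1(1) ps by (simp add: lift1_def proj1_def)
    with that(1) W(1,2) V(2) show thesis by blast
  next
    case (2 q)
    have "s v = Inr (q v)" if "v \<in> W" for v
      using fun_cong[OF 2(2), of v] that by (auto simp: compose_def)
    then have "lift2 n W q p" using 2(1) ps by (simp add: lift2_def proj2_def)
    with that(2) W(1,2) V(2) show thesis by blast
  qed
qed

lemma lift1_restrict:
  assumes "lift1 n V q p" "openin (Euclidean_space n) W" "W \<subseteq> V"
  shows "lift1 n W (restrict q W) p"
  using assms diffeology_restrict[OF X1[unfolded diffeological_space_def]] by (auto simp: lift1_def)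

text \<open>The second conclusion accompanies the first so that naturality of a form on
  \<open>X1\<close> can be applied to \<open>q\<close> and to \<open>F\<close> as a map from the
  preimage of \<open>V\<close> to \<open>V\<close>.\<close>

lemma lift1_compose:
  assumes q: "lift1 n V q p" and F: "smooth_between n' U' n U F" and "V \<subseteq> U"
  defines "W \<equiv> {u \<in> U'. F u \<in> V}"
  shows "lift1 n' W (compose W q F) (compose U' p F)" "smooth_between n' W n V F"
proof -
  have V: "(n, V, q) \<in> plots X1" using q by (simp add: lift1_def)
  show F': "smooth_between n' W n V F"
    unfolding W_def
    by (rule smooth_between_restrict[OF F X1_plot(1)[OF V]
          smooth_between_vimage_open[OF F X1_plot(1)[OF V]]]) auto
  show "lift1 n' W (compose W q F) (compose U' p F)"
    using q diffeology_compose[OF X1[unfolded diffeological_space_def] V F']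
    by (auto simp: lift1_def compose_def W_def)
qed

lemma lift2_compose:
  assumes q: "lift2 n V q p" and F: "smooth_between n' U' n U F" and "V \<subseteq> U"
  defines "W \<equiv> {u \<in> U'. F u \<in> V}"
  shows "lift2 n' W (compose W q F) (compose U' p F)" "smooth_between n' W n V F"
proof -
  have V: "(n, V, q) \<in> plots X2" using q by (simp add: lift2_def)
  show F': "smooth_between n' W n V F"
    unfolding W_def
    by (rule smooth_between_restrict[OF F X2_plot(1)[OF V]
          smooth_between_vimage_open[OF F X2_plot(1)[OF V]]]) auto
  show "lift2 n' W (compose W q F) (compose U' p F)"
    using q diffeology_compose[OF X2[unfolded diffeological_space_def] V F']
    by (auto simp: lift2_def compose_def W_def)
qed

section \<open>Independence of the chosen lift\<close>

lemma compatible_apply: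
  assumes w: "compatible X1 X2 Y f \<omega>1 \<omega>2"
    and q: "(n, U, q) \<in> plots X1" "\<And>u. u \<in> U \<Longrightarrow> q u \<in> Y"
  shows "\<omega>1 (n, U, q) = \<omega>2 (n, U, compose U f q)"
proof -
  have qY: "(n, U, q) \<in> plots (subset_space X1 Y)" using q by (auto simp: subset_space_def)
  have "(n, U, compose U f q) \<in> plots X2" using f qY by (simp add: smooth_def)
  then have fq: "(n, U, compose U f q) \<in> plots (subset_space X2 (f ` Y))"
    using q(2) by (auto simp: subset_space_def compose_def)
  \<comment> \<open>Plots are extensional, so composing with an inclusion returns the same HOL
    function and both inclusions disappear from the compatibility condition.\<close>
  have "compose U (\<lambda>y. y) q = q" "compose U (\<lambda>z. z) (compose U f q) = compose U f q"
    using X1_plot(3)[OF q(1)] by (auto simp: compose_def fun_eq_iff extensional_def)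
  moreover have "pullback (subset_space X1 Y) (\<lambda>y. y) \<omega>1 (n, U, q) =
      pullback (subset_space X1 Y) f (pullback (subset_space X2 (f ` Y)) (\<lambda>z. z) \<omega>2) (n, U, q)"
    using w by (simp add: compatible_def)
  ultimately show ?thesis using qY fq by (simp add: pullback_apply)
qed

text \<open>Invariance concerns two plots with the same domain, so both lifts are restricted to
  \<open>V \<inter> V'\<close> before it is used; \<open>forms_restrict\<close> carries the equality
  at \<open>u\<close> back to the original lifts.\<close>

lemma lifts_agree_11:
  assumes w: "\<omega>1 \<in> forms m X1" "f_invariant X1 Y f \<omega>1"
    and q: "lift1 n V q p" "u \<in> V" and q': "lift1 n V' q' p" "u \<in> V'"
  shows "\<omega>1 (n, V, q) u = \<omega>1 (n, V', q') u"
proof -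
  have qp: "(n, V, q) \<in> plots X1" and qp': "(n, V', q') \<in> plots X1"
    using q(1) q'(1) by (simp_all add: lift1_def)
  let ?W = "V \<inter> V'"
  have W: "openin (Euclidean_space n) ?W"
    using X1_plot(1)[OF qp] X1_plot(1)[OF qp'] by (rule openin_Int)
  have l: "lift1 n ?W (restrict q ?W) p" "lift1 n ?W (restrict q' ?W) p"
    using lift1_restrict[OF q(1) W] lift1_restrict[OF q'(1) W] by auto
  have "f_equivalent Y f ?W (restrict q ?W) (restrict q' ?W)"
    unfolding f_equivalent_def
  proof (intro ballI impI)
    fix v assume v: "v \<in> ?W" "restrict q ?W v \<noteq> restrict q' ?W v"
    then have "proj1 (q v) = proj1 (q' v)" using q(1) q'(1) by (auto simp: lift1_def)
    then show "restrict q ?W v \<in> Y \<and> restrict q' ?W v \<in> Y \<and> f (restrict q ?W v) = f (restrict q' ?W v)"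
      using v proj1_eq_iff[OF X1_plot(2)[OF qp] X1_plot(2)[OF qp'], of v v] by auto
  qed
  then have "\<omega>1 (n, ?W, restrict q ?W) = \<omega>1 (n, ?W, restrict q' ?W)"
    using w(2) l unfolding f_invariant_def lift1_def by blast
  then show ?thesis
    using forms_restrict[OF X1 w(1) qp W, of u] forms_restrict[OF X1 w(1) qp' W, of u] q(2) q'(2)
    by simp
qed

lemma lifts_agree_12:
  assumes w: "\<omega>1 \<in> forms m X1" "\<omega>2 \<in> forms m X2" "compatible X1 X2 Y f \<omega>1 \<omega>2"
    and q: "lift1 n V q p" "u \<in> V" and q': "lift2 n V' q' p" "u \<in> V'"
  shows "\<omega>1 (n, V, q) u = \<omega>2 (n, V', q') u"
proof -
  have qp: "(n, V, q) \<in> plots X1" and qp': "(n, V', q') \<in> plots X2"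
    using q(1) q'(1) by (simp_all add: lift1_def lift2_def)
  let ?W = "V \<inter> V'"
  have W: "openin (Euclidean_space n) ?W"
    using X1_plot(1)[OF qp] X2_plot(1)[OF qp'] by (rule openin_Int)
  have fq: "q v \<in> Y \<and> f (q v) = q' v" if "v \<in> ?W" for v
    using proj1_eq_proj2_iff[OF X1_plot(2)[OF qp] X2_plot(2)[OF qp'], of v v] that q(1) q'(1)
    by (auto simp: lift1_def lift2_def)
  have "(n, ?W, restrict q ?W) \<in> plots X1"
    using lift1_restrict[OF q(1) W] by (auto simp: lift1_def)
  then have "\<omega>1 (n, ?W, restrict q ?W) = \<omega>2 (n, ?W, compose ?W f (restrict q ?W))"
    using fq by (intro compatible_apply[OF w(3)]) auto
  also have "compose ?W f (restrict q ?W) = restrict q' ?W"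
    using fq by (auto simp: compose_def fun_eq_iff)
  finally have "\<omega>1 (n, ?W, restrict q ?W) u = \<omega>2 (n, ?W, restrict q' ?W) u" by (simp only:)
  then show ?thesis
    using forms_restrict[OF X1 w(1) qp W, of u] forms_restrict[OF X2 w(2) qp' W, of u] q(2) q'(2)
    by simp
qed

lemma lifts_agree_22:
  assumes w: "\<omega>2 \<in> forms m X2"
    and q: "lift2 n V q p" "u \<in> V" and q': "lift2 n V' q' p" "u \<in> V'"
  shows "\<omega>2 (n, V, q) u = \<omega>2 (n, V', q') u"
proof -
  have qp: "(n, V, q) \<in> plots X2" and qp': "(n, V', q') \<in> plots X2"
    using q(1) q'(1) by (simp_all add: lift2_def)
  let ?W = "V \<inter> V'"
  have W: "openin (Euclidean_space n) ?W"
    using X2_plot(1)[OF qp] X2_plot(1)[OF qp'] by (rule openin_Int)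
  have "restrict q ?W = restrict q' ?W"
    using q(1) q'(1) proj2_eq_iff[OF X2_plot(2)[OF qp] X2_plot(2)[OF qp']]
    by (fastforce simp: lift2_def fun_eq_iff)
  then show ?thesis
    using forms_restrict[OF X2 w qp W, of u] forms_restrict[OF X2 w qp' W, of u] q(2) q'(2)
    by simp
qed

section \<open>The form glued from a compatible pair\<close>

definition lift_value ::
  "'a form \<Rightarrow> 'b form \<Rightarrow> nat \<Rightarrow> (nat \<Rightarrow> real) set \<Rightarrow> ((nat \<Rightarrow> real) \<Rightarrow> ('a + 'b) set) \<Rightarrow> (nat \<Rightarrow> real) \<Rightarrow>
   ((nat \<Rightarrow> real) list \<Rightarrow> real) \<Rightarrow> bool"
  where "lift_value \<omega>1 \<omega>2 n U p u a \<longleftrightarrow>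
    (\<exists>V q. V \<subseteq> U \<and> u \<in> V \<and> lift1 n V q p \<and> a = \<omega>1 (n, V, q) u) \<or>
    (\<exists>V q. V \<subseteq> U \<and> u \<in> V \<and> lift2 n V q p \<and> a = \<omega>2 (n, V, q) u)"

text \<open>The description ranges over covectors at a single \<open>u\<close>, so no choice of a
  cover of \<open>U\<close> by domains of lifts enters the definition. It is meaningful for pairs in
  \<open>comp_pairs\<close>, where values through different lifts agree.\<close>

definition glue_form :: "'a form \<Rightarrow> 'b form \<Rightarrow> ('a + 'b) set form"
  where "glue_form \<omega>1 \<omega>2 = (\<lambda>(n, U, p) u.
    if (n, U, p) \<in> plots G \<and> u \<in> U then THE a. lift_value \<omega>1 \<omega>2 n U p u a else (\<lambda>vs. 0))"

definition comp_pairs :: "nat \<Rightarrow> ('a form \<times> 'b form) set"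
  where "comp_pairs m = {(\<omega>1, \<omega>2). \<omega>1 \<in> forms m X1 \<and> \<omega>2 \<in> forms m X2 \<and>
    compatible X1 X2 Y f \<omega>1 \<omega>2 \<and> f_invariant X1 Y f \<omega>1}"

lemma comp_pairsD:
  assumes "(\<omega>1, \<omega>2) \<in> comp_pairs m"
  shows "\<omega>1 \<in> forms m X1" "\<omega>2 \<in> forms m X2" "compatible X1 X2 Y f \<omega>1 \<omega>2" "f_invariant X1 Y f \<omega>1"
  using assms by (simp_all add: comp_pairs_def)

lemma lift_value_unique:
  assumes w: "(\<omega>1, \<omega>2) \<in> comp_pairs m"
    and a: "lift_value \<omega>1 \<omega>2 n U p u a" and b: "lift_value \<omega>1 \<omega>2 n U p u b"
  shows "a = b"
proof -
  note w = comp_pairsD[OF w]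
  show ?thesis
    using a b unfolding lift_value_def
  proof (elim disjE exE conjE, goal_cases)
    case 1
    then show ?case by (metis lifts_agree_11[OF w(1,4)])
  next
    case 2
    then show ?case by (metis lifts_agree_12[OF w(1-3)])
  next
    case 3
    then show ?case by (metis lifts_agree_12[OF w(1-3)])
  next
    case 4
    then show ?case by (metis lifts_agree_22[OF w(2)])
  qed
qed

text \<open>Uniqueness turns the definite description into an evaluation rule valid for every lift.
  In particular one lift on \<open>V\<close> computes the glued form at all points of
  \<open>V\<close>, which reduces smoothness and naturality to those of
  \<open>\<omega>1\<close>.\<close>

lemma glue_form_lift1:
  assumes w: "(\<omega>1, \<omega>2) \<in> comp_pairs m" and p: "(n, U, p) \<in> plots G"
    and V: "V \<subseteq> U" "u \<in> V" "lift1 n V q p"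
  shows "glue_form \<omega>1 \<omega>2 (n, U, p) u = \<omega>1 (n, V, q) u"
proof -
  have l: "lift_value \<omega>1 \<omega>2 n U p u (\<omega>1 (n, V, q) u)" using V unfolding lift_value_def by blast
  have "(THE a. lift_value \<omega>1 \<omega>2 n U p u a) = \<omega>1 (n, V, q) u"
    using the_equality[where P = "lift_value \<omega>1 \<omega>2 n U p u", OF l lift_value_unique[OF w _ l]] by simp
  then show ?thesis using p V by (auto simp: glue_form_def)
qed

lemma glue_form_lift2:
  assumes w: "(\<omega>1, \<omega>2) \<in> comp_pairs m" and p: "(n, U, p) \<in> plots G"
    and V: "V \<subseteq> U" "u \<in> V" "lift2 n V q p"
  shows "glue_form \<omega>1 \<omega>2 (n, U, p) u = \<omega>2 (n, V, q) u"
proof -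
  have l: "lift_value \<omega>1 \<omega>2 n U p u (\<omega>2 (n, V, q) u)" using V unfolding lift_value_def by blast
  have "(THE a. lift_value \<omega>1 \<omega>2 n U p u a) = \<omega>2 (n, V, q) u"
    using the_equality[where P = "lift_value \<omega>1 \<omega>2 n U p u", OF l lift_value_unique[OF w _ l]] by simp
  then show ?thesis using p V by (auto simp: glue_form_def)
qed

lemma glue_form_smooth:
  assumes w: "(\<omega>1, \<omega>2) \<in> comp_pairs m" and p: "(n, U, p) \<in> plots G"
  shows "smooth_to_covectors m n n U (glue_form \<omega>1 \<omega>2 (n, U, p))"
proof (rule smooth_to_covectors_local[OF G_plot_open[OF p]])
  note w' = comp_pairsD[OF w]
  fix u assume "u \<in> U"
  with p show "\<exists>V. openin (Euclidean_space n) V \<and> u \<in> V \<and>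
      smooth_to_covectors m n n V (glue_form \<omega>1 \<omega>2 (n, U, p))"
  proof (cases rule: lift_exists)
    case (1 V q)
    then have q: "(n, V, q) \<in> plots X1" by (simp add: lift1_def)
    note V = X1_plot(1)[OF q]
    have "smooth_to_covectors m n n V (glue_form \<omega>1 \<omega>2 (n, U, p))"
      by (rule smooth_to_covectors_cong[OF V forms_smooth[OF w'(1) q]])
         (rule glue_form_lift1[OF w p 1(1) _ 1(3), symmetric])
    with V 1(2) show ?thesis by blast
  next
    case (2 V q)
    then have q: "(n, V, q) \<in> plots X2" by (simp add: lift2_def)
    note V = X2_plot(1)[OF q]
    have "smooth_to_covectors m n n V (glue_form \<omega>1 \<omega>2 (n, U, p))"
      by (rule smooth_to_covectors_cong[OF V forms_smooth[OF w'(2) q]])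
         (rule glue_form_lift2[OF w p 2(1) _ 2(3), symmetric])
    with V 2(2) show ?thesis by blast
  qed
qed

lemma glue_form_compose:
  assumes w: "(\<omega>1, \<omega>2) \<in> comp_pairs m" and p: "(n, U, p) \<in> plots G"
    and F: "smooth_between n' U' n U F"
  shows "glue_form \<omega>1 \<omega>2 (n', U', compose U' p F) =
    domain_pullback m n' U' F (glue_form \<omega>1 \<omega>2 (n, U, p))"
proof
  note w' = comp_pairsD[OF w]
  fix u
  have pF: "(n', U', compose U' p F) \<in> plots G"
    using diffeology_compose gluing_diffeological p F unfolding diffeological_space_def by blast
  show "glue_form \<omega>1 \<omega>2 (n', U', compose U' p F) u =
    domain_pullback m n' U' F (glue_form \<omega>1 \<omega>2 (n, U, p)) u"
  proof (cases "u \<in> U'")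
    case False
    then show ?thesis by (auto simp: glue_form_def domain_pullback_def)
  next
    case True
    from p smooth_between_mem[OF F True] show ?thesis
    proof (cases rule: lift_exists)
      case (1 V q)
      let ?W = "{u \<in> U'. F u \<in> V}"
      note C = lift1_compose[OF 1(3) F 1(1)]
      have "glue_form \<omega>1 \<omega>2 (n', U', compose U' p F) u = \<omega>1 (n', ?W, compose ?W q F) u"
        using True 1(2) by (intro glue_form_lift1[OF w pF _ _ C(1)]) auto
      also have "\<dots> = domain_pullback m n' ?W F (\<omega>1 (n, V, q)) u"
        using forms_compose[OF w'(1) _ C(2)] 1(3) by (simp add: lift1_def)
      \<comment> \<open>At \<open>u\<close> a pullback involves its form only through the value at
        \<open>F u\<close>, which lies in \<open>V\<close>. There the lift computes the glued form,
        and it is immaterial that \<open>?W\<close> is smaller than \<open>U'\<close>.\<close>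
      also have "\<dots> = domain_pullback m n' U' F (glue_form \<omega>1 \<omega>2 (n, U, p)) u"
        using True 1(2) by (simp add: domain_pullback_def glue_form_lift1[OF w p 1] cong: if_cong)
      finally show ?thesis .
    next
      case (2 V q)
      let ?W = "{u \<in> U'. F u \<in> V}"
      note C = lift2_compose[OF 2(3) F 2(1)]
      have "glue_form \<omega>1 \<omega>2 (n', U', compose U' p F) u = \<omega>2 (n', ?W, compose ?W q F) u"
        using True 2(2) by (intro glue_form_lift2[OF w pF _ _ C(1)]) auto
      also have "\<dots> = domain_pullback m n' ?W F (\<omega>2 (n, V, q)) u"
        using forms_compose[OF w'(2) _ C(2)] 2(3) by (simp add: lift2_def)
      also have "\<dots> = domain_pullback m n' U' F (glue_form \<omega>1 \<omega>2 (n, U, p)) u"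
        using True 2(2) by (simp add: domain_pullback_def glue_form_lift2[OF w p 2] cong: if_cong)
      finally show ?thesis .
    qed
  qed
qed

lemma glue_form_in_forms:
  assumes w: "(\<omega>1, \<omega>2) \<in> comp_pairs m"
  shows "glue_form \<omega>1 \<omega>2 \<in> forms m G"
  unfolding forms_def
proof (intro CollectI conjI allI impI)
  fix P assume "P \<notin> plots G"
  then show "glue_form \<omega>1 \<omega>2 P = (\<lambda>u vs. 0)"
    by (cases P) (auto simp: glue_form_def fun_eq_iff)
next
  fix n U p assume p: "(n, U, p) \<in> plots G"
  show "glue_form \<omega>1 \<omega>2 (n, U, p) \<in> domain_forms m n U"
    using glue_form_smooth[OF w p] by (auto simp: domain_forms_def glue_form_def)
  show "\<And>n' U' F. smooth_between n' U' n U F \<Longrightarrow> glue_form \<omega>1 \<omega>2 (n', U', compose U' p F) =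
      domain_pullback m n' U' F (glue_form \<omega>1 \<omega>2 (n, U, p))"
    by (rule glue_form_compose[OF w p])
qed

section \<open>Splitting a form on the gluing\<close>

definition split_form :: "('a + 'b) set form \<Rightarrow> 'a form \<times> 'b form"
  where "split_form \<omega> = (pullback X1 proj1 \<omega>, pullback X2 proj2 \<omega>)"

lemma proj1_plot: "(n, U, q) \<in> plots X1 \<Longrightarrow> (n, U, compose U proj1 q) \<in> plots G"
  using smooth_proj1 by (simp add: smooth_def)

lemma proj2_plot: "(n, U, q) \<in> plots X2 \<Longrightarrow> (n, U, compose U proj2 q) \<in> plots G"
  using smooth_proj2 by (simp add: smooth_def)

text \<open>Both conditions hold because the plots they compare become equal in the gluing:
  \<open>f\<close>-equivalent plots of \<open>X1\<close> have the same projection, and so do a plot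
  \<open>q\<close> with values in \<open>Y\<close> and the plot \<open>compose U f q\<close> of
  \<open>X2\<close>.\<close>

lemma split_form_in_comp_pairs:
  assumes w: "\<omega> \<in> forms m G"
  shows "split_form \<omega> \<in> comp_pairs m"
proof -
  have "f_invariant X1 Y f (pullback X1 proj1 \<omega>)"
    unfolding f_invariant_def
  proof (intro allI impI)
    fix n U p p'
    assume p: "(n, U, p) \<in> plots X1" and p': "(n, U, p') \<in> plots X1"
      and eq: "f_equivalent Y f U p p'"
    have "proj1 (p u) = proj1 (p' u)" if "u \<in> U" for u
      using proj1_eq_iff[OF X1_plot(2)[OF p that] X1_plot(2)[OF p' that]] eq that
      by (auto simp: f_equivalent_def)
    then have "compose U proj1 p = compose U proj1 p'" by (auto simp: compose_def fun_eq_iff)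
    then show "pullback X1 proj1 \<omega> (n, U, p) = pullback X1 proj1 \<omega> (n, U, p')"
      using p p' by (simp add: pullback_apply)
  qed
  moreover have "compatible X1 X2 Y f (pullback X1 proj1 \<omega>) (pullback X2 proj2 \<omega>)"
    unfolding compatible_def
  proof
    fix P :: "'a plot"
    obtain n U q where P: "P = (n, U, q)" by (cases P)
    show "pullback (subset_space X1 Y) (\<lambda>y. y) (pullback X1 proj1 \<omega>) P =
      pullback (subset_space X1 Y) f
        (pullback (subset_space X2 (f ` Y)) (\<lambda>z. z) (pullback X2 proj2 \<omega>)) P"
    proof (cases "P \<in> plots (subset_space X1 Y)")
      case True
      then have qY: "(n, U, q) \<in> plots (subset_space X1 Y)" by (simp add: P)
      then have q: "(n, U, q) \<in> plots X1" "q ` U \<subseteq> Y" by (auto simp: subset_space_def)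
      have fq: "(n, U, compose U f q) \<in> plots X2" using f qY by (simp add: smooth_def)
      then have fqY: "(n, U, compose U f q) \<in> plots (subset_space X2 (f ` Y))"
        using q(2) by (auto simp: subset_space_def compose_def)
      have "compose U (\<lambda>y. y) q = q" "compose U (\<lambda>z. z) (compose U f q) = compose U f q"
        using X1_plot(3)[OF q(1)] by (auto simp: compose_def fun_eq_iff extensional_def)
      moreover have "proj1 (q u) = proj2 (f (q u))" if "u \<in> U" for u
        using proj1_eq_proj2_iff[OF X1_plot(2)[OF q(1) that] f_into] q(2) that by auto
      then have "compose U proj1 q = compose U proj2 (compose U f q)"
        by (auto simp: compose_def fun_eq_iff)
      ultimately show ?thesis
        unfolding P using qY fqY q(1) fq by (simp add: pullback_apply)
    qed (simp add: P pullback_def)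
  qed
  ultimately show ?thesis
    using pullback_forms[OF X1 smooth_proj1 w] pullback_forms[OF X2 smooth_proj2 w]
    by (simp add: split_form_def comp_pairs_def)
qed

text \<open>A plot \<open>q\<close> of a factor is a lift of its own projection, on its whole
  domain, so the glued form evaluates on that projection to the original form. Elsewhere both sides
  are the zero extension.\<close>

lemma split_form_glue_form:
  assumes w: "(\<omega>1, \<omega>2) \<in> comp_pairs m"
  shows "split_form (glue_form \<omega>1 \<omega>2) = (\<omega>1, \<omega>2)"
proof -
  note w' = comp_pairsD[OF w]
  have "pullback X1 proj1 (glue_form \<omega>1 \<omega>2) (n, U, q) u = \<omega>1 (n, U, q) u" for n U q u
  proof (cases "(n, U, q) \<in> plots X1 \<and> u \<in> U")
    case True
    then have "lift1 n U q (compose U proj1 q)" by (simp add: lift1_def compose_def)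
    then show ?thesis
      using True glue_form_lift1[OF w proj1_plot order_refl] by (simp add: pullback_apply)
  next
    case False
    then show ?thesis
      using forms_outside[OF w'(1)] forms_not_in_domain[OF w'(1)]
      by (auto simp: pullback_def glue_form_def)
  qed
  moreover have "pullback X2 proj2 (glue_form \<omega>1 \<omega>2) (n, U, q) u = \<omega>2 (n, U, q) u" for n U q u
  proof (cases "(n, U, q) \<in> plots X2 \<and> u \<in> U")
    case True
    then have "lift2 n U q (compose U proj2 q)" by (simp add: lift2_def compose_def)
    then show ?thesis
      using True glue_form_lift2[OF w proj2_plot order_refl] by (simp add: pullback_apply)
  next
    case False
    then show ?thesis
      using forms_outside[OF w'(2)] forms_not_in_domain[OF w'(2)]
      by (auto simp: pullback_def glue_form_def)
  qed
  ultimately show ?thesis by (auto simp: split_form_def fun_eq_iff)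
qed

text \<open>Projecting a local lift of \<open>p\<close> gives back a restriction of
  \<open>p\<close>, and a form has the same value at \<open>u\<close> on \<open>p\<close> as on a
  restriction to a neighbourhood of \<open>u\<close>.\<close>

lemma glue_form_split_form:
  assumes w: "\<omega> \<in> forms m G"
  shows "glue_form (pullback X1 proj1 \<omega>) (pullback X2 proj2 \<omega>) = \<omega>"
proof -
  let ?w1 = "pullback X1 proj1 \<omega>" and ?w2 = "pullback X2 proj2 \<omega>"
  have cp: "(?w1, ?w2) \<in> comp_pairs m"
    using split_form_in_comp_pairs[OF w] by (simp add: split_form_def)
  have "glue_form ?w1 ?w2 (n, U, p) u = \<omega> (n, U, p) u" for n U p u
  proof (cases "(n, U, p) \<in> plots G \<and> u \<in> U")
    case False
    then show ?thesis
      using forms_outside[OF w] forms_not_in_domain[OF w] by (auto simp: glue_form_def)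
  next
    case True
    then have p: "(n, U, p) \<in> plots G" and "u \<in> U" by auto
    then show ?thesis
    proof (cases rule: lift_exists)
      case (1 V q)
      then have q: "(n, V, q) \<in> plots X1" by (simp add: lift1_def)
      have "compose V proj1 q = restrict p V"
        using 1(3) by (auto simp: lift1_def compose_def fun_eq_iff)
      then have "?w1 (n, V, q) u = \<omega> (n, V, restrict p V) u" using q by (simp add: pullback_apply)
      also have "\<dots> = \<omega> (n, U, p) u"
        by (rule forms_restrict[OF gluing_diffeological w p X1_plot(1)[OF q] 1(1,2)])
      finally show ?thesis using glue_form_lift1[OF cp p 1] by simp
    next
      case (2 V q)
      then have q: "(n, V, q) \<in> plots X2" by (simp add: lift2_def)
      have "compose V proj2 q = restrict p V"
        using 2(3) by (auto simp: lift2_def compose_def fun_eq_iff)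
      then have "?w2 (n, V, q) u = \<omega> (n, V, restrict p V) u" using q by (simp add: pullback_apply)
      also have "\<dots> = \<omega> (n, U, p) u"
        by (rule forms_restrict[OF gluing_diffeological w p X2_plot(1)[OF q] 2(1,2)])
      finally show ?thesis using glue_form_lift2[OF cp p 2] by simp
    qed
  qed
  then show ?thesis by (auto simp: fun_eq_iff)
qed

section \<open>Smoothness of splitting and gluing\<close>

lemma points_Omega_comp: "points (Omega_comp m X1 X2 Y f) = comp_pairs m"
  by (simp add: Omega_comp_def subset_space_def comp_pairs_def)

lemma plots_Omega_comp_iff:
  "(k, U', Q) \<in> plots (Omega_comp m X1 X2 Y f) \<longleftrightarrow> Q \<in> U' \<rightarrow>\<^sub>E comp_pairs m \<and>
    (k, U', compose U' fst Q) \<in> plots (Omega m X1) \<and> (k, U', compose U' snd Q) \<in> plots (Omega m X2)"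
proof -
  have "plots (Omega_comp m X1 X2 Y f) =
      {(k, U', Q). (k, U', Q) \<in> plots (prod_space (Omega m X1) (Omega m X2)) \<and> Q ` U' \<subseteq> comp_pairs m}"
    by (simp add: Omega_comp_def subset_space_def comp_pairs_def)
  moreover have "comp_pairs m \<subseteq> forms m X1 \<times> forms m X2" by (auto simp: comp_pairs_def)
  \<comment> \<open>A parametrization must have an open domain; here this is recovered from the
    first component being a plot.\<close>
  moreover have "openin (Euclidean_space k) U'" if "(k, U', compose U' fst Q) \<in> plots (Omega m X1)"
    using that by (simp add: plots_Omega_iff)
  ultimately show ?thesis
    unfolding prod_plots[OF Omega_diffeological[OF X1] Omega_diffeological[OF X2]]
    by (auto simp: parametrizations_def PiE_iff)
qed

lemma smooth_split_form: "smooth (Omega m G) (Omega_comp m X1 X2 Y f) split_form"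
  unfolding smooth_def points_Omega points_Omega_comp
proof (intro conjI allI impI)
  show "split_form \<in> forms m G \<rightarrow> comp_pairs m" using split_form_in_comp_pairs by blast
  fix k U' Q assume Q: "(k, U', Q) \<in> plots (Omega m G)"
  have "compose U' fst (compose U' split_form Q) = (\<lambda>u\<in>U'. pullback X1 proj1 (Q u))"
    "compose U' snd (compose U' split_form Q) = (\<lambda>u\<in>U'. pullback X2 proj2 (Q u))"
    by (auto simp: compose_def split_form_def fun_eq_iff)
  moreover have "compose U' split_form Q \<in> U' \<rightarrow>\<^sub>E comp_pairs m"
    using Q split_form_in_comp_pairs by (intro compose_in_PiE[of _ _ "forms m G"]) (auto simp: plots_Omega_iff)
  ultimately show "(k, U', compose U' split_form Q) \<in> plots (Omega_comp m X1 X2 Y f)"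
    using pullback_plot_Omega[OF X1 smooth_proj1 Q] pullback_plot_Omega[OF X2 smooth_proj2 Q]
    by (simp add: plots_Omega_comp_iff)
qed

text \<open>A lift \<open>q\<close> depends on the plot \<open>p\<close> of the gluing alone and not
  on the parameter of the family. Hence on all of U' x V the test map of the glued family on
  \<open>p\<close> equals that of one component of \<open>Q\<close> on \<open>q\<close>, which is
  smooth by assumption; such products cover U' x U.\<close>

lemma smooth_glue_form:
  "smooth (Omega_comp m X1 X2 Y f) (Omega m G) (\<lambda>(\<omega>1, \<omega>2). glue_form \<omega>1 \<omega>2)" (is "smooth _ _ ?g")
  unfolding smooth_def points_Omega points_Omega_comp
proof (intro conjI allI impI)
  show into: "?g \<in> comp_pairs m \<rightarrow> forms m G" using glue_form_in_forms by auto
  fix k U' Q assume "(k, U', Q) \<in> plots (Omega_comp m X1 X2 Y f)"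
  then have Q: "Q \<in> U' \<rightarrow>\<^sub>E comp_pairs m" "(k, U', compose U' fst Q) \<in> plots (Omega m X1)"
    "(k, U', compose U' snd Q) \<in> plots (Omega m X2)"
    by (simp_all add: plots_Omega_comp_iff)
  have U': "openin (Euclidean_space k) U'" using Q(2) by (simp add: plots_Omega_iff)
  have Qp: "(fst (Q u), snd (Q u)) \<in> comp_pairs m" if "u \<in> U'" for u using Q(1) that by auto
  have "smooth_to_covectors m n (k + n) (domain_product k U' n U)
      (\<lambda>w. compose U' ?g Q (first_part k w) (n, U, p) (second_part k w))" (is "smooth_to_covectors m n (k + n) _ ?h")
    if p: "(n, U, p) \<in> plots G" for n U p
  proof (rule smooth_to_covectors_local[OF domain_product_open[OF U' G_plot_open[OF p]]])
    fix w assume w: "w \<in> domain_product k U' n U"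
    then have "second_part k w \<in> U" by (simp add: domain_product_def)
    with p show "\<exists>W. openin (Euclidean_space (k + n)) W \<and> w \<in> W \<and> smooth_to_covectors m n (k + n) W ?h"
    proof (cases rule: lift_exists)
      case (1 V q)
      then have q: "(n, V, q) \<in> plots X1" by (simp add: lift1_def)
      let ?W = "domain_product k U' n V"
      have W: "openin (Euclidean_space (k + n)) ?W"
        by (rule domain_product_open[OF U' X1_plot(1)[OF q]])
      have "smooth_to_covectors m n (k + n) ?W
          (\<lambda>w. compose U' fst Q (first_part k w) (n, V, q) (second_part k w))"
        using Q(2) q by (simp add: plots_Omega_iff)
      then have "smooth_to_covectors m n (k + n) ?W ?h"
      proof (rule smooth_to_covectors_cong[OF W])
        fix w assume "w \<in> ?W"
        then show "compose U' fst Q (first_part k w) (n, V, q) (second_part k w) = ?h w"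
          using glue_form_lift1[OF Qp p 1(1) _ 1(3)]
          by (simp add: domain_product_def compose_def case_prod_beta)
      qed
      moreover have "w \<in> ?W" using w 1(2) by (simp add: domain_product_def)
      ultimately show ?thesis using W by blast
    next
      case (2 V q)
      then have q: "(n, V, q) \<in> plots X2" by (simp add: lift2_def)
      let ?W = "domain_product k U' n V"
      have W: "openin (Euclidean_space (k + n)) ?W"
        by (rule domain_product_open[OF U' X2_plot(1)[OF q]])
      have "smooth_to_covectors m n (k + n) ?W
          (\<lambda>w. compose U' snd Q (first_part k w) (n, V, q) (second_part k w))"
        using Q(3) q by (simp add: plots_Omega_iff)
      then have "smooth_to_covectors m n (k + n) ?W ?h"
      proof (rule smooth_to_covectors_cong[OF W])
        fix w assume "w \<in> ?W"
        then show "compose U' snd Q (first_part k w) (n, V, q) (second_part k w) = ?h w"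
          using glue_form_lift2[OF Qp p 2(1) _ 2(3)]
          by (simp add: domain_product_def compose_def case_prod_beta)
      qed
      moreover have "w \<in> ?W" using w 2(2) by (simp add: domain_product_def)
      ultimately show ?thesis using W by blast
    qed
  qed
  then show "(k, U', compose U' ?g Q) \<in> plots (Omega m G)"
    using U' compose_in_PiE[OF Q(1) into] by (simp add: plots_Omega_iff)
qed

lemma diffeomorphism_split_form: "diffeomorphism (Omega m G) (Omega_comp m X1 X2 Y f) split_form"
proof -
  let ?g = "\<lambda>(\<omega>1, \<omega>2). glue_form \<omega>1 \<omega>2"
  have gs: "?g (split_form \<omega>) = \<omega>" if "\<omega> \<in> forms m G" for \<omega>
    using glue_form_split_form[OF that] by (simp add: split_form_def)
  have sg: "?g P \<in> forms m G" "split_form (?g P) = P" if "P \<in> comp_pairs m" for P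
    using that glue_form_in_forms split_form_glue_form by (cases P; simp)+
  have bij: "bij_betw split_form (forms m G) (comp_pairs m)"
    by (rule bij_betw_byWitness[where f' = ?g]) (use gs sg split_form_in_comp_pairs in auto)
  \<comment> \<open>\<open>inv_into\<close> and gluing are compared on \<open>comp_pairs m\<close>
    only. Plots of the target take their values there, so this is enough to transfer
    smoothness.\<close>
  have inv: "inv_into (forms m G) split_form P = ?g P" if "P \<in> comp_pairs m" for P
    by (rule inv_into_f_eq[OF bij_betw_imp_inj_on[OF bij]]) (rule sg[OF that])+
  have "smooth (Omega_comp m X1 X2 Y f) (Omega m G) (inv_into (forms m G) split_form)"
    unfolding smooth_def
  proof (intro conjI allI impI)
    show "inv_into (forms m G) split_form \<in> points (Omega_comp m X1 X2 Y f) \<rightarrow> points (Omega m G)"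
      using sg(1) by (auto simp: points_Omega_comp inv)
    fix k U' Q assume Q: "(k, U', Q) \<in> plots (Omega_comp m X1 X2 Y f)"
    have "compose U' (inv_into (forms m G) split_form) Q = compose U' ?g Q"
      using Q inv by (fastforce simp: compose_def fun_eq_iff plots_Omega_comp_iff)
    then show "(k, U', compose U' (inv_into (forms m G) split_form) Q) \<in> plots (Omega m G)"
      using smooth_glue_form Q by (simp add: smooth_def)
  qed
  then show ?thesis
    using smooth_split_form bij by (simp add: diffeomorphism_def points_Omega_comp)
qed

end

theorem theorem1:
  fixes X1 :: "'a diffeo_space" and X2 :: "'b diffeo_space"
    and Y :: "'a set" and f :: "'a \<Rightarrow> 'b" and m :: nat
  assumes "diffeological_space X1"
    and "diffeological_space X2"
    and "Y \<subseteq> points X1"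
    and "smooth (subset_space X1 Y) X2 f"
  shows "diffeomorphic (Omega m (gluing X1 X2 Y f)) (Omega_comp m X1 X2 Y f)"
proof -
  interpret gluing_data X1 X2 Y f using assms by unfold_locales
  show ?thesis unfolding diffeomorphic_def using diffeomorphism_split_form by blast
qed

end
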